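(* Let $\{\boldsymbol u_{\rm ms}^n\}\subset\boldsymbol V_{\rm ms}$ solve the explicit multiscale scheme $$(\rho\,\pi D_{tt}\boldsymbol u_{\rm ms}^n,\pi\boldsymbol w)+a(\boldsymbol u_{\rm ms}^n,\boldsymbol w)=(\boldsymbol f^n,\pi\boldsymbol w)\qquad\text{for all }\boldsymbol w\in\boldsymbol V_{\rm ms},\ n\ge1 .$$ Assume the CFL condition $\dfrac{\tau}{2H\sqrt\beta}<1$. Then there is a constant $C>0$, independent of $n$, $\{\boldsymbol u_{\rm ms}^n\}$ and $\{\boldsymbol f^n\}$, such that $$\|D_t\boldsymbol u_{\rm ms}^{n+\frac12}\|_\rho^2+\|\bar{\boldsymbol u}_{\rm ms}^{n+\frac12}\|_a^2\le C\Bigl[E^{\frac12}_{\pi,\rho}(\boldsymbol u_{\rm ms})+\tau^2\Bigl(\sum_{k=1}^n\|\pi(\rho^{-1}\boldsymbol f^k)\|_\rho\Bigr)^2\Bigr].$$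
   Context: **Fine discretization.** $\Omega\subset\mathbb R^2$ is a polygonal domain; $\rho>0$ is the mass density and $\lambda,\mu$ are the (possibly highly heterogeneous, high-contrast) Lamé coefficients; "contrast" refers to the ratio between largest and smallest values of the coefficients. $(\cdot,\cdot)$ is the $L^2(\Omega)$ inner product of scalar, vector or matrix fields; $(\cdot,\cdot)_K$, $(\cdot,\cdot)_e$ are the $L^2$ products on $K$ and on an edge $e$. $\mathcal A\underline\tau=\frac1{2\mu}\bigl(\underline\tau-\frac{\lambda}{2\lambda+2\mu}(\operatorname{tr}\underline\tau)\underline I\bigr)$, and $\operatorname{as}(\underline w)=w_{12}-w_{21}$. $\mathcal T_M$ is a partition of $\Omega$ into quadrilaterals $M$ (macro-elements); each $M$ is cut into four subcells by joining an interior point to the midpoints of its edges. $\mathcal T_h$ is the set of subcells, $\mathcal F_{pr}^{1/2}$ the set of half-edges of edges of $\mathcal T_M$, $\mathcal F_{dl}$ the set of subcell edges interior to macro-elements, and $\mathcal T_D$ the set of interaction regions $D$ (union of the subcells sharing a common vertex of $\mathcal T_M$). $h$ is the fine mesh size. For $e=\partial E^+\cap\partial E^-$, $\llbracket q\rrbracket=q|_{E^+}-q|_{E^-}$ and the unit normal $\boldsymbol n$ on $e$ points from $E^+$ to $E^-$; on boundary edges $\llbracket q\rrbracket=q$ and $\boldsymbol n$ is outward. Spaces: $\underline\Sigma_h$ = matrix fields constant on each subcell of $\mathcal T_h$ with $\llbracket\underline w\boldsymbol n\rrbracket|_e=0$ for all $e\in\mathcal F_{pr}^{1/2}$ not on $\partial\Omega$;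 $\boldsymbol U_h$ = $\mathbb R^2$-valued fields constant on each $M\in\mathcal T_M$; $\Gamma_h$ = scalar fields constant on each $D\in\mathcal T_D$. Operators: $\mathcal J:\boldsymbol U_h\to\underline\Sigma_h$, $(\mathcal J(\boldsymbol v),\underline w)=\sum_{e\in\mathcal F_{dl}}(\boldsymbol v,\llbracket\underline w\boldsymbol n\rrbracket)_e$ for all $\underline w\in\underline\Sigma_h$; $\operatorname{as}^*:\Gamma_h\to\underline\Sigma_h$, $(\operatorname{as}(\underline w),\gamma)=(\underline w,\operatorname{as}^*(\gamma))$ for all $\underline w\in\underline\Sigma_h$; $\mathcal A_h:\underline\Sigma_h\to\underline\Sigma_h$, $(\mathcal A_h\underline\tau,\underline w)=(\mathcal A\underline\tau,\underline w)$ for all $\underline w\in\underline\Sigma_h$. For $\boldsymbol v\in\boldsymbol U_h$, $\gamma_h(\boldsymbol v)\in\Gamma_h$ is determined by $(\mathcal J(\boldsymbol v)-\mathcal A_h\operatorname{as}^*(\gamma_h(\boldsymbol v)),\operatorname{as}^*(\xi))=0$ for all $\xi\in\Gamma_h$, and $\mathcal P_\star(\boldsymbol v)=\mathcal J(\boldsymbol v)-\mathcal A_h\operatorname{as}^*(\gamma_h(\boldsymbol v))$. The energy form is $a(\boldsymbol v,\boldsymbol w)=(\mathcal A_h^{-1}\mathcal P_\star(\boldsymbol v),\mathcal P_\star(\boldsymbol w))$, symmetric positive definite on $\boldsymbol U_h$; $\|\boldsymbol v\|_a^2=a(\boldsymbol v,\boldsymbol v)$, $\|\boldsymbol v\|_\rho^2=(\rho\boldsymbol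 v,\boldsymbol v)$. **Multiscale space.** $\mathcal T_H=\{K_1,\dots,K_N\}$ is a conforming quasi-uniform coarse partition of $\Omega$ into quadrilaterals of mesh size $H$, each a connected union of elements of $\mathcal T_M$. $K_{i,m}$ is $K_i$ enlarged by $m$ layers of coarse elements. $\boldsymbol U_h(K)$ is the restriction of $\boldsymbol U_h$ to $K$ (identified with its extension by zero). $\underline\Sigma_h(K_i)$ is the conforming subspace of those $\underline w\in\underline\Sigma_h$ supported in $K_i$, $\Gamma_h(K_i)$ the restriction of $\Gamma_h$ to $K_i$. The local form $a_i$ on $\boldsymbol U_h(K_i)$ is defined exactly as $a$ with $\Omega,\underline\Sigma_h,\Gamma_h,\mathcal F_{dl}$ replaced by $K_i,\underline\Sigma_h(K_i),\Gamma_h(K_i),\mathcal F_{dl}\cap K_i$. Let $(\lambda_j^i,\boldsymbol\phi_j^i)$, $\lambda_1^i\le\lambda_2^i\le\cdots$, be the eigenpairs of $a_i(\boldsymbol\phi_j^i,\boldsymbol w)=\frac{\lambda_j^i}{H^2}(\rho\boldsymbol\phi_j^i,\boldsymbol w)_{K_i}$ for all $\boldsymbol w\in\boldsymbol U_h(K_i)$, normalized by $(\rho\boldsymbol\phi_j^i,\boldsymbol\phi_{j'}^i)=\delta_{jj'}$. For chosen $l_i\le\dim\boldsymbol U_h(K_i)$, $\boldsymbol V_{\rm aux}=\bigoplus_{i=1}^N\operatorname{span}\{\boldsymbol\phi_j^i:1\le j\le l_i\}$, and $\pi\boldsymbol v=\sum_{i=1}^N\sum_{j=1}^{l_i}(\rho\boldsymbol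 v,\boldsymbol\phi_j^i)\boldsymbol\phi_j^i$ (also defined for $\boldsymbol v\in L^2(\Omega)^2$). The localized basis function $\boldsymbol\psi_{j,m}^i$ is the minimizer of $a(\boldsymbol\psi,\boldsymbol\psi)$ over $\boldsymbol\psi\in\boldsymbol U_h(K_{i,m})$ (extended by zero) with $\pi\boldsymbol\psi=\boldsymbol\phi_j^i$, and $\boldsymbol V_{\rm ms}=\operatorname{span}\{\boldsymbol\psi_{j,m}^i:1\le i\le N,1\le j\le l_i\}$. **Time discretization and energy.** $\tau=T/N_T$ is the time step, $t_n=n\tau$, $\boldsymbol f^n=\boldsymbol f(t_n)\in L^2(\Omega)^2$ is the source. $D_{tt}\boldsymbol v^n=(\boldsymbol v^{n+1}-2\boldsymbol v^n+\boldsymbol v^{n-1})/\tau^2$, $D_t\boldsymbol v^{n+\frac12}=(\boldsymbol v^{n+1}-\boldsymbol v^n)/\tau$, $\bar{\boldsymbol v}^{n+\frac12}=(\boldsymbol v^{n+1}+\boldsymbol v^n)/2$, and $$E_{\pi,\rho}^{n+\frac12}(\boldsymbol v)=\tfrac12\|\pi D_t\boldsymbol v^{n+\frac12}\|_\rho^2-\tfrac{\tau^2}{8}\|D_t\boldsymbol v^{n+\frac12}\|_a^2+\tfrac12\|\bar{\boldsymbol v}^{n+\frac12}\|_a^2 .$$ $\beta>0$ denotes a constant (depending on mesh regularity and $\max_{i,\,j\le l_i}\lambda_j^i$, independent of $h,H$ and the contrast) such that $\|\pi\boldsymbol v\|_\rho^2\ge\beta H^2\|\boldsymbol v\|_a^2$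 for all $\boldsymbol v\in\boldsymbol V_{\rm ms}$. *)

theory Defs
  imports "HOL-Analysis.Analysis" "HOL-Library.Function_Algebras"
begin

section \<open>Quadrilaterals and partitions\<close>

type_synonym pt = "real^2"
type_synonym mat2 = "real^2^2"

(* vertices in cyclic order *)
datatype quad = Quad pt pt pt pt

fun corners :: "quad \<Rightarrow> pt set" where
  "corners (Quad a b c d) = {a, b, c, d}"

fun sides :: "quad \<Rightarrow> pt set set" where
  "sides (Quad a b c d) =
     {closed_segment a b, closed_segment b c, closed_segment c d, closed_segment d a}"

fun boundary_path :: "quad \<Rightarrow> real \<Rightarrow> pt" where
  "boundary_path (Quad a b c d) =
     linepath a b +++ linepath b c +++ linepath c d +++ linepath d a"

(* Convexity is not required. *)
fun is_quadrilateral :: "quad \<Rightarrow> bool" where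
  "is_quadrilateral (Quad a b c d) \<longleftrightarrow>
     simple_path (boundary_path (Quad a b c d)) \<and>
     \<not> collinear {a, b, c} \<and> \<not> collinear {b, c, d} \<and>
     \<not> collinear {c, d, a} \<and> \<not> collinear {d, a, b}"

(* the open quadrilateral, i.e. the bounded component cut out by the boundary curve *)
definition cell :: "quad \<Rightarrow> pt set" where
  "cell Q = inside (path_image (boundary_path Q))"

definition region :: "quad \<Rightarrow> pt set" where
  "region Q = cell Q \<union> path_image (boundary_path Q)"

definition polygonal_domain :: "pt set \<Rightarrow> bool" where
  "polygonal_domain Om \<longleftrightarrow>
     open Om \<and> connected Om \<and> bounded Om \<and> Om \<noteq> {} \<and>
     (\<exists>S. finite S \<and> frontier Om = (\<Union>(a, b)\<in>S. closed_segment a b))"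

definition conforming :: "quad set \<Rightarrow> bool" where
  "conforming T \<longleftrightarrow>
     (\<forall>Q\<in>T. \<forall>Q'\<in>T. Q \<noteq> Q' \<longrightarrow>
        region Q \<inter> region Q' \<subseteq> \<Union>(sides Q \<inter> sides Q') \<union> (corners Q \<inter> corners Q'))"

(* Disjointness of distinct open cells is a consequence of conformity. *)
definition quad_partition :: "pt set \<Rightarrow> quad set \<Rightarrow> bool" where
  "quad_partition Om T \<longleftrightarrow>
     finite T \<and> (\<forall>Q\<in>T. is_quadrilateral Q \<and> cell Q \<subseteq> Om) \<and>
     (\<Union>Q\<in>T. region Q) = closure Om \<and> conforming T"

text \<open>Cutting a macro-element with interior point \<open>z\<close>.  Edges of the fine mesh are
  endpoint pairs; half-edges run from the vertex to the midpoint and dual edges from the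
  interior point to the midpoint, so that an edge shared by two cells is one pair.\<close>

fun subcells :: "quad \<Rightarrow> pt \<Rightarrow> quad set" where
  "subcells (Quad a b c d) z =
     {Quad a (midpoint a b) z (midpoint d a), Quad b (midpoint b c) z (midpoint a b),
      Quad c (midpoint c d) z (midpoint b c), Quad d (midpoint d a) z (midpoint c d)}"

fun half_edges :: "quad \<Rightarrow> (pt \<times> pt) set" where
  "half_edges (Quad a b c d) =
     {(a, midpoint a b), (b, midpoint a b), (b, midpoint b c), (c, midpoint b c),
      (c, midpoint c d), (d, midpoint c d), (d, midpoint d a), (a, midpoint d a)}"

fun dual_edges :: "quad \<Rightarrow> pt \<Rightarrow> (pt \<times> pt) set" where
  "dual_edges (Quad a b c d) z =
     {(z, midpoint a b), (z, midpoint b c), (z, midpoint c d), (z, midpoint d a)}"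

definition seg :: "pt \<times> pt \<Rightarrow> pt set" where
  "seg e = closed_segment (fst e) (snd e)"


section \<open>The vector space of fields\<close>

definition fscale :: "real \<Rightarrow> ('a \<Rightarrow> 'b::real_vector) \<Rightarrow> 'a \<Rightarrow> 'b" where
  "fscale r f = (\<lambda>x. r *\<^sub>R f x)"

interpretation fields: vector_space "fscale :: real \<Rightarrow> ('a \<Rightarrow> 'b::real_vector) \<Rightarrow> 'a \<Rightarrow> 'b"
  by unfold_locales (auto simp: fscale_def fun_eq_iff algebra_simps)

(* the L2 product on K of scalar, vector or (Frobenius) matrix fields *)
definition ip :: "pt set \<Rightarrow> (pt \<Rightarrow> 'b::real_inner) \<Rightarrow> (pt \<Rightarrow> 'b) \<Rightarrow> real" where
  "ip K f g = (LINT x:K|lebesgue. f x \<bullet> g x)"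

definition L2_fields :: "pt set \<Rightarrow> (pt \<Rightarrow> pt) set" where
  "L2_fields Om = {f. f \<in> borel_measurable (lebesgue_on Om) \<and>
                      integrable (lebesgue_on Om) (\<lambda>x. (norm (f x))\<^sup>2)}"

definition edge_ip :: "pt \<times> pt \<Rightarrow> (pt \<Rightarrow> pt) \<Rightarrow> (pt \<Rightarrow> pt) \<Rightarrow> real" where
  "edge_ip e p q = dist (fst e) (snd e) *
     integral {0..1} (\<lambda>t. p (linepath (fst e) (snd e) t) \<bullet> q (linepath (fst e) (snd e) t))"

(* Of the almost-everywhere class of a piecewise constant field, the representative that
   vanishes off the union of the (open) pieces is used, so equality of fields is equality
   of functions. *)
definition piecewise_const :: "pt set set \<Rightarrow> (pt \<Rightarrow> 'b::zero) set" where
  "piecewise_const P = {f. (\<forall>A\<in>P. \<exists>c. \<forall>x\<in>A. f x = c) \<and> (\<forall>x. x \<notin> \<Union>P \<longrightarrow> f x = 0)}"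

definition restr :: "pt set \<Rightarrow> (pt \<Rightarrow> 'b::zero) \<Rightarrow> pt \<Rightarrow> 'b" where
  "restr K f = (\<lambda>x. if x \<in> K then f x else 0)"

(* the trace on E of a field that is constant on the open cell of E *)
definition cell_value :: "(pt \<Rightarrow> 'b) \<Rightarrow> quad \<Rightarrow> 'b" where
  "cell_value w E = w (SOME x. x \<in> cell E)"


section \<open>Fine discretization\<close>

record fine_problem =
  Dom :: "pt set"
  macros :: "quad set"
  centre :: "quad \<Rightarrow> pt"
  rho :: "pt \<Rightarrow> real"
  lame_lambda :: "pt \<Rightarrow> real"
  lame_mu :: "pt \<Rightarrow> real"

(* The coefficient hypotheses allow lame_lambda \<le> 0 as long as lame_lambda + lame_mu is
   bounded below by a positive constant, which is what coercivity needs in 2D. *)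
definition fine_discretization :: "('z) fine_problem_scheme \<Rightarrow> bool" where
  "fine_discretization P \<longleftrightarrow>
     polygonal_domain (Dom P) \<and>
     quad_partition (Dom P) (macros P) \<and>
     (\<forall>M\<in>macros P. centre P M \<in> cell M \<and>
        (\<forall>(z, m)\<in>dual_edges M (centre P M). open_segment z m \<subseteq> cell M)) \<and>
     rho P \<in> borel_measurable (lebesgue_on (Dom P)) \<and>
     lame_lambda P \<in> borel_measurable (lebesgue_on (Dom P)) \<and>
     lame_mu P \<in> borel_measurable (lebesgue_on (Dom P)) \<and>
     (\<exists>c C. 0 < c \<and> (\<forall>x\<in>Dom P.
        c \<le> rho P x \<and> rho P x \<le> C \<and> c \<le> lame_mu P x \<and> lame_mu P x \<le> C \<and>
        c \<le> lame_lambda P x + lame_mu P x \<and> \<bar>lame_lambda P x\<bar> \<le> C))"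

definition fine_cells :: "('z) fine_problem_scheme \<Rightarrow> quad set" where
  "fine_cells P = (\<Union>M\<in>macros P. subcells M (centre P M))"

definition F_pr :: "('z) fine_problem_scheme \<Rightarrow> (pt \<times> pt) set" where
  "F_pr P = (\<Union>M\<in>macros P. half_edges M)"

definition F_dl :: "('z) fine_problem_scheme \<Rightarrow> (pt \<times> pt) set" where
  "F_dl P = (\<Union>M\<in>macros P. dual_edges M (centre P M))"

(* interaction regions, each as the union of its open subcells *)
definition interaction_regions :: "('z) fine_problem_scheme \<Rightarrow> pt set set" where
  "interaction_regions P =
     (\<lambda>p. \<Union>E\<in>{E \<in> fine_cells P. p \<in> corners E}. cell E) ` (\<Union>M\<in>macros P. corners M)"

(* the unit normal on e pointing from E1 to E2 *)
definition unit_normal :: "quad \<Rightarrow> quad \<Rightarrow> pt \<times> pt \<Rightarrow> pt" where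
  "unit_normal E1 E2 e = (THE n. norm n = 1 \<and> n \<bullet> (snd e - fst e) = 0 \<and>
     (\<forall>x\<in>open_segment (fst e) (snd e).
        \<forall>\<^sub>F s in at_right 0. x + s *\<^sub>R n \<in> region E2 \<and> x - s *\<^sub>R n \<in> region E1))"

(* The jump of w n across an edge shared by two subcells.  Exchanging the two subcells also
   reverses the normal, so the result does not depend on the pair that is chosen.  Boundary
   edges do not occur where this is used. *)
definition normal_jump :: "('z) fine_problem_scheme \<Rightarrow> (pt \<Rightarrow> mat2) \<Rightarrow> pt \<times> pt \<Rightarrow> pt" where
  "normal_jump P w e =
     (let (E1, E2) = (SOME (E1, E2). E1 \<in> fine_cells P \<and> E2 \<in> fine_cells P \<and> E1 \<noteq> E2 \<and>
                                     seg e \<in> sides E1 \<and> seg e \<in> sides E2)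
      in (cell_value w E1 - cell_value w E2) *v unit_normal E1 E2 e)"

definition Sigma_h :: "('z) fine_problem_scheme \<Rightarrow> (pt \<Rightarrow> mat2) set" where
  "Sigma_h P = {w \<in> piecewise_const (cell ` fine_cells P).
                  \<forall>e\<in>F_pr P. \<not> seg e \<subseteq> frontier (Dom P) \<longrightarrow> normal_jump P w e = 0}"

definition U_h :: "('z) fine_problem_scheme \<Rightarrow> (pt \<Rightarrow> pt) set" where
  "U_h P = piecewise_const (cell ` macros P)"

definition Gamma_h :: "('z) fine_problem_scheme \<Rightarrow> (pt \<Rightarrow> real) set" where
  "Gamma_h P = piecewise_const (interaction_regions P)"

definition Sigma_on :: "('z) fine_problem_scheme \<Rightarrow> pt set \<Rightarrow> (pt \<Rightarrow> mat2) set" where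
  "Sigma_on P K = {w \<in> Sigma_h P. \<forall>x. x \<notin> K \<longrightarrow> w x = 0}"

definition U_on :: "('z) fine_problem_scheme \<Rightarrow> pt set \<Rightarrow> (pt \<Rightarrow> pt) set" where
  "U_on P K = restr K ` U_h P"

definition Gamma_on :: "('z) fine_problem_scheme \<Rightarrow> pt set \<Rightarrow> (pt \<Rightarrow> real) set" where
  "Gamma_on P K = restr K ` Gamma_h P"

definition asym :: "mat2 \<Rightarrow> real" where
  "asym w = w $ 1 $ 2 - w $ 2 $ 1"

definition compliance :: "('z) fine_problem_scheme \<Rightarrow> (pt \<Rightarrow> mat2) \<Rightarrow> pt \<Rightarrow> mat2" where
  "compliance P t = (\<lambda>x. (1 / (2 * lame_mu P x)) *\<^sub>R
     (t x - (lame_lambda P x / (2 * lame_lambda P x + 2 * lame_mu P x) * trace (t x)) *\<^sub>R mat 1))"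

text \<open>All operators and the energy form are defined on a region \<open>K\<close>; taking \<open>K = Dom P\<close>
  gives the global ones and a coarse element for \<open>K\<close> gives the local ones.\<close>

definition representer :: "('z) fine_problem_scheme \<Rightarrow> pt set \<Rightarrow> ((pt \<Rightarrow> mat2) \<Rightarrow> real) \<Rightarrow> pt \<Rightarrow> mat2"
  where "representer P K L = (THE s. s \<in> Sigma_on P K \<and> (\<forall>w\<in>Sigma_on P K. ip K s w = L w))"

definition J_op :: "('z) fine_problem_scheme \<Rightarrow> pt set \<Rightarrow> (pt \<Rightarrow> pt) \<Rightarrow> pt \<Rightarrow> mat2" where
  "J_op P K v = representer P K
     (\<lambda>w. \<Sum>e\<in>{e \<in> F_dl P. seg e \<subseteq> closure K}. edge_ip e v (\<lambda>_. normal_jump P w e))"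

definition as_star :: "('z) fine_problem_scheme \<Rightarrow> pt set \<Rightarrow> (pt \<Rightarrow> real) \<Rightarrow> pt \<Rightarrow> mat2" where
  "as_star P K g = representer P K (\<lambda>w. ip K (\<lambda>x. asym (w x)) g)"

definition A_op :: "('z) fine_problem_scheme \<Rightarrow> pt set \<Rightarrow> (pt \<Rightarrow> mat2) \<Rightarrow> pt \<Rightarrow> mat2" where
  "A_op P K t = representer P K (\<lambda>w. ip K (compliance P t) w)"

(* On a proper subregion as_star may fail to be injective and the equation then leaves
   gamma undetermined, but P_star does not depend on the solution chosen. *)
definition gamma_op :: "('z) fine_problem_scheme \<Rightarrow> pt set \<Rightarrow> (pt \<Rightarrow> pt) \<Rightarrow> pt \<Rightarrow> real" where
  "gamma_op P K v = (SOME g. g \<in> Gamma_on P K \<and>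
     (\<forall>\<xi>\<in>Gamma_on P K. ip K (J_op P K v - A_op P K (as_star P K g)) (as_star P K \<xi>) = 0))"

definition P_star :: "('z) fine_problem_scheme \<Rightarrow> pt set \<Rightarrow> (pt \<Rightarrow> pt) \<Rightarrow> pt \<Rightarrow> mat2" where
  "P_star P K v = J_op P K v - A_op P K (as_star P K (gamma_op P K v))"

definition energy_on ::
  "('z) fine_problem_scheme \<Rightarrow> pt set \<Rightarrow> (pt \<Rightarrow> pt) \<Rightarrow> (pt \<Rightarrow> pt) \<Rightarrow> real" where
  "energy_on P K v w =
     ip K (inv_into (Sigma_on P K) (A_op P K) (P_star P K v)) (P_star P K w)"

definition a_form :: "('z) fine_problem_scheme \<Rightarrow> (pt \<Rightarrow> pt) \<Rightarrow> (pt \<Rightarrow> pt) \<Rightarrow> real" where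
  "a_form P = energy_on P (Dom P)"

definition ip_rho ::
  "('z) fine_problem_scheme \<Rightarrow> pt set \<Rightarrow> (pt \<Rightarrow> pt) \<Rightarrow> (pt \<Rightarrow> pt) \<Rightarrow> real" where
  "ip_rho P K v w = ip K (\<lambda>x. rho P x *\<^sub>R v x) w"

definition norm_a :: "('z) fine_problem_scheme \<Rightarrow> (pt \<Rightarrow> pt) \<Rightarrow> real" where
  "norm_a P v = sqrt (a_form P v v)"

definition norm_rho :: "('z) fine_problem_scheme \<Rightarrow> (pt \<Rightarrow> pt) \<Rightarrow> real" where
  "norm_rho P v = sqrt (ip_rho P (Dom P) v v)"


section \<open>Multiscale space\<close>

(* coarse elements, eigenpairs and basis functions are indexed from 1 *)
record ms_problem = fine_problem +
  n_coarse :: nat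
  coarse :: "nat \<Rightarrow> quad"
  layers :: nat
  n_aux :: "nat \<Rightarrow> nat"
  eigval :: "nat \<Rightarrow> nat \<Rightarrow> real"
  eigfun :: "nat \<Rightarrow> nat \<Rightarrow> pt \<Rightarrow> pt"
  basis_fun :: "nat \<Rightarrow> nat \<Rightarrow> pt \<Rightarrow> pt"

definition mesh_size_H :: "('z) ms_problem_scheme \<Rightarrow> real" where
  "mesh_size_H P = Max ((\<lambda>i. diameter (region (coarse P i))) ` {1..n_coarse P})"

definition coarse_partition :: "real \<Rightarrow> ('z) ms_problem_scheme \<Rightarrow> bool" where
  "coarse_partition \<kappa> P \<longleftrightarrow>
     inj_on (coarse P) {1..n_coarse P} \<and>
     quad_partition (Dom P) (coarse P ` {1..n_coarse P}) \<and>
     (\<forall>i\<in>{1..n_coarse P}. connected (region (coarse P i)) \<and>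
        (\<exists>S\<subseteq>macros P. region (coarse P i) = (\<Union>M\<in>S. region M))) \<and>
     0 < \<kappa> \<and> (\<forall>i\<in>{1..n_coarse P}. \<exists>x. ball x (\<kappa> * mesh_size_H P) \<subseteq> region (coarse P i))"

fun enlarged :: "('z) ms_problem_scheme \<Rightarrow> nat \<Rightarrow> nat \<Rightarrow> pt set" where
  "enlarged P i 0 = region (coarse P i)"
| "enlarged P i (Suc m) =
     (\<Union>j\<in>{j \<in> {1..n_coarse P}. region (coarse P j) \<inter> enlarged P i m \<noteq> {}}. region (coarse P j))"

definition local_eigenpairs :: "('z) ms_problem_scheme \<Rightarrow> bool" where
  "local_eigenpairs P \<longleftrightarrow>
     (\<forall>i\<in>{1..n_coarse P}.
        let K = region (coarse P i); d = fields.dim (U_on P K) in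
          (\<forall>j\<in>{1..d}. eigfun P i j \<in> U_on P K \<and>
             (\<forall>w\<in>U_on P K. energy_on P K (eigfun P i j) w =
                eigval P i j / (mesh_size_H P)\<^sup>2 * ip_rho P K (eigfun P i j) w)) \<and>
          (\<forall>j\<in>{1..d}. \<forall>j'\<in>{1..d}. j \<le> j' \<longrightarrow> eigval P i j \<le> eigval P i j') \<and>
          (\<forall>j\<in>{1..d}. \<forall>j'\<in>{1..d}.
             ip_rho P (Dom P) (eigfun P i j) (eigfun P i j') = (if j = j' then 1 else 0)) \<and>
          n_aux P i \<le> d)"

definition aux_proj :: "('z) ms_problem_scheme \<Rightarrow> (pt \<Rightarrow> pt) \<Rightarrow> pt \<Rightarrow> pt" where
  "aux_proj P v = (\<Sum>i=1..n_coarse P. \<Sum>j=1..n_aux P i.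
     fscale (ip_rho P (Dom P) v (eigfun P i j)) (eigfun P i j))"

definition localized_basis :: "('z) ms_problem_scheme \<Rightarrow> bool" where
  "localized_basis P \<longleftrightarrow>
     (\<forall>i\<in>{1..n_coarse P}. \<forall>j\<in>{1..n_aux P i}.
        is_arg_min (\<lambda>v. a_form P v v)
          (\<lambda>v. v \<in> U_on P (enlarged P i (layers P)) \<and> aux_proj P v = eigfun P i j)
          (basis_fun P i j))"

definition multiscale_setup :: "real \<Rightarrow> ('z) ms_problem_scheme \<Rightarrow> bool" where
  "multiscale_setup \<kappa> P \<longleftrightarrow>
     fine_discretization P \<and> coarse_partition \<kappa> P \<and> local_eigenpairs P \<and> localized_basis P"

definition V_ms :: "('z) ms_problem_scheme \<Rightarrow> (pt \<Rightarrow> pt) set" where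
  "V_ms P = fields.span {basis_fun P i j | i j. i \<in> {1..n_coarse P} \<and> j \<in> {1..n_aux P i}}"


section \<open>Time discretization\<close>

(* Index n stands for the half step n + 1/2 in Dt_half, mean_half and discrete_energy. *)

definition Dtt :: "real \<Rightarrow> (nat \<Rightarrow> pt \<Rightarrow> pt) \<Rightarrow> nat \<Rightarrow> pt \<Rightarrow> pt" where
  "Dtt \<tau> u n = fscale (1 / \<tau>\<^sup>2) (u (n + 1) - fscale 2 (u n) + u (n - 1))"

definition Dt_half :: "real \<Rightarrow> (nat \<Rightarrow> pt \<Rightarrow> pt) \<Rightarrow> nat \<Rightarrow> pt \<Rightarrow> pt" where
  "Dt_half \<tau> u n = fscale (1 / \<tau>) (u (n + 1) - u n)"

definition mean_half :: "(nat \<Rightarrow> pt \<Rightarrow> pt) \<Rightarrow> nat \<Rightarrow> pt \<Rightarrow> pt" where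
  "mean_half u n = fscale (1 / 2) (u (n + 1) + u n)"

definition discrete_energy ::
  "('z) ms_problem_scheme \<Rightarrow> real \<Rightarrow> (nat \<Rightarrow> pt \<Rightarrow> pt) \<Rightarrow> nat \<Rightarrow> real" where
  "discrete_energy P \<tau> u n =
     1 / 2 * (norm_rho P (aux_proj P (Dt_half \<tau> u n)))\<^sup>2
     - \<tau>\<^sup>2 / 8 * (norm_a P (Dt_half \<tau> u n))\<^sup>2
     + 1 / 2 * (norm_a P (mean_half u n))\<^sup>2"

definition explicit_scheme ::
  "('z) ms_problem_scheme \<Rightarrow> real \<Rightarrow> nat \<Rightarrow> (nat \<Rightarrow> pt \<Rightarrow> pt) \<Rightarrow> (nat \<Rightarrow> pt \<Rightarrow> pt) \<Rightarrow> bool" where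
  "explicit_scheme P \<tau> N f u \<longleftrightarrow>
     (\<forall>n\<le>N. u n \<in> V_ms P) \<and>
     (\<forall>n. 1 \<le> n \<and> n < N \<longrightarrow> (\<forall>w\<in>V_ms P.
        ip_rho P (Dom P) (aux_proj P (Dtt \<tau> u n)) (aux_proj P w) + a_form P (u n) w
          = ip (Dom P) (f n) (aux_proj P w)))"

end

theory Submission
  imports Defs
begin

text \<open>The scheme is a leapfrog method \<open>m (D\<^sub>t\<^sub>t u\<^sup>n, w) + a (u\<^sup>n, w) = (f\<^sup>n, \<pi> w)\<close> for the two forms
  \<open>m (v, w) = (\<rho> \<pi> v, \<pi> w)\<close> and \<open>a\<close>.  If both are symmetric, bilinear and nonnegative, testing with
  \<open>u\<^sup>n\<^sup>+\<^sup>1 - u\<^sup>n\<^sup>-\<^sup>1\<close> gives the increment of the discrete energy as half the work of the source.  The CFL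
  condition together with the inverse inequality makes the energy dominate \<open>m (D\<^sub>t u, D\<^sub>t u)\<close>, so the
  work is at most a constant times the product of \<open>\<tau>\<close>, the norm of the projected source and the sum of
  the roots of two consecutive energies.  Dividing by that sum gives linear growth of the root of the energy, which
  is the claim up to one step (\<open>leapfrog_stability\<close>).

  The remaining step replaces \<open>\<pi> D\<^sub>t u\<close> by \<open>D\<^sub>t u\<close> in the \<open>\<rho>\<close>-norm.  The projection maps the localized
  basis functions to the eigenfunctions, and these are orthonormal: within a coarse element by
  normalization, across coarse elements because the supports are disjoint.  Hence the coefficients
  of \<open>v\<close> in the localized basis are those of \<open>\<pi> v\<close> in an orthonormal family, and the triangle inequality bounds
  \<open>v\<close> by \<open>\<pi> v\<close> (\<open>norm_le_aux_proj\<close>).  The constant depends on the space but not on the solution.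

  What takes most of the work is that \<open>a\<close> has the asserted algebraic properties
  (\<open>semi_inner_a_form\<close>), since it is assembled from operators given by definite descriptions and
  choices.  They are well defined by the Riesz representation on the finite-dimensional
  space of stresses (\<open>riesz_representation\<close>), which needs the \<open>L\<^sup>2\<close> product to be definite there; this is a
  fact about the mesh, namely that each nonempty subcell meets the domain
  (\<open>fine_cell_meets_domain\<close>).  The stress attached to a displacement is then characterized by
  an orthogonality relation with a unique solution, so it is linear in the displacement, and
  \<open>a\<close> is the compliance product of two such stresses.\<close>

section \<open>Semi-inner products on subspaces\<close>

definition functional_on :: "(real \<Rightarrow> 'v \<Rightarrow> 'v) \<Rightarrow> 'v::ab_group_add set \<Rightarrow> ('v \<Rightarrow> real) \<Rightarrow> bool" where
  "functional_on sc V L \<longleftrightarrow>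
     (\<forall>x\<in>V. \<forall>y\<in>V. L (x + y) = L x + L y) \<and> (\<forall>c. \<forall>x\<in>V. L (sc c x) = c * L x)"

lemma functional_onI:
  assumes "\<And>x y. x \<in> V \<Longrightarrow> y \<in> V \<Longrightarrow> L (x + y) = L x + L y"
    and "\<And>c x. x \<in> V \<Longrightarrow> L (sc c x) = c * L x"
  shows "functional_on sc V L"
  using assms by (auto simp: functional_on_def)

lemma functional_on_add: "functional_on sc V L \<Longrightarrow> x \<in> V \<Longrightarrow> y \<in> V \<Longrightarrow> L (x + y) = L x + L y"
  by (simp add: functional_on_def)

lemma functional_on_scale: "functional_on sc V L \<Longrightarrow> x \<in> V \<Longrightarrow> L (sc c x) = c * L x"
  by (simp add: functional_on_def)

lemma functional_on_subset: "functional_on sc V L \<Longrightarrow> W \<subseteq> V \<Longrightarrow> functional_on sc W L"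
  unfolding functional_on_def by blast

text \<open>Definiteness is left out, so that one set of facts serves the \<open>L\<^sup>2\<close> products, the energy form and
  the product of projected fields.  The carrier is a subspace because an integral is additive
  only on integrable fields.\<close>

locale semi_inner = vector_space sc
  for sc :: "real \<Rightarrow> 'v::ab_group_add \<Rightarrow> 'v" +
  fixes V :: "'v set" and b :: "'v \<Rightarrow> 'v \<Rightarrow> real"
  assumes subspace: "subspace V"
    and sym: "\<And>x y. x \<in> V \<Longrightarrow> y \<in> V \<Longrightarrow> b x y = b y x"
    and functional: "\<And>y. y \<in> V \<Longrightarrow> functional_on sc V (\<lambda>x. b x y)"
    and nonneg: "\<And>x. x \<in> V \<Longrightarrow> 0 \<le> b x x"
begin

lemmas zero_mem = subspace_0[OF subspace]
  and add_mem = subspace_add[OF subspace]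
  and diff_mem = subspace_diff[OF subspace]
  and scale_mem = subspace_scale[OF subspace]
  and sum_mem = subspace_sum[OF subspace]

lemmas mem = zero_mem add_mem diff_mem scale_mem

lemma add_left: "x \<in> V \<Longrightarrow> y \<in> V \<Longrightarrow> z \<in> V \<Longrightarrow> b (x + y) z = b x z + b y z"
  using functional_on_add[OF functional] .

lemma scale_left: "x \<in> V \<Longrightarrow> z \<in> V \<Longrightarrow> b (sc c x) z = c * b x z"
  using functional_on_scale[OF functional] .

lemma functional_diff:
  assumes L: "functional_on sc V L" and xy: "x \<in> V" "y \<in> V"
  shows "L (x - y) = L x - L y"
proof -
  have "L (x - y) = L (x + sc (- 1) y)" by simp
  also have "\<dots> = L x + (- 1) * L y"
    using functional_on_add[OF L] functional_on_scale[OF L] scale_mem xy by metis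
  finally show ?thesis by simp
qed

lemma functional_zero:
  assumes L: "functional_on sc V L"
  shows "L 0 = 0"
  using functional_on_scale[OF L zero_mem, of 0] by simp

lemma diff_left: "x \<in> V \<Longrightarrow> y \<in> V \<Longrightarrow> z \<in> V \<Longrightarrow> b (x - y) z = b x z - b y z"
  using functional_diff[OF functional] .

lemma add_right: "x \<in> V \<Longrightarrow> y \<in> V \<Longrightarrow> z \<in> V \<Longrightarrow> b x (y + z) = b x y + b x z"
  using add_left[of y z x] sym add_mem by metis

lemma scale_right: "x \<in> V \<Longrightarrow> z \<in> V \<Longrightarrow> b x (sc c z) = c * b x z"
  using scale_left[of z x c] by (simp add: sym[of x] scale_mem)

lemma diff_right: "x \<in> V \<Longrightarrow> y \<in> V \<Longrightarrow> z \<in> V \<Longrightarrow> b x (y - z) = b x y - b x z"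
  using diff_left[of y z x] by (simp add: sym[of x] diff_mem)

lemma functional_right: "x \<in> V \<Longrightarrow> functional_on sc V (b x)"
  by (rule functional_onI) (simp_all add: add_right scale_right)

lemma zero_left: "z \<in> V \<Longrightarrow> b 0 z = 0"
  using functional_zero[OF functional] .

lemma functional_sum:
  assumes L: "functional_on sc V L" and f: "\<And>i. i \<in> I \<Longrightarrow> f i \<in> V"
  shows "L (\<Sum>i\<in>I. f i) = (\<Sum>i\<in>I. L (f i))"
  using f
proof (induction I rule: infinite_finite_induct)
  case (insert x F)
  then show ?case by (simp add: functional_on_add[OF L] sum_mem)
qed (simp_all add: functional_zero[OF L])

lemma sum_left:
  assumes "\<And>i. i \<in> I \<Longrightarrow> f i \<in> V" and "z \<in> V"
  shows "b (\<Sum>i\<in>I. f i) z = (\<Sum>i\<in>I. b (f i) z)"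
  using functional_sum[OF functional[OF assms(2)], of I f] assms(1) by simp

lemma sum_right:
  assumes "\<And>i. i \<in> I \<Longrightarrow> f i \<in> V" and "z \<in> V"
  shows "b z (\<Sum>i\<in>I. f i) = (\<Sum>i\<in>I. b z (f i))"
  using sum_left[OF assms] sym[OF assms(2)] sum_mem[of I f] assms by simp

lemmas expand = add_left diff_left scale_left add_right diff_right scale_right

lemma Cauchy_Schwarz_square:
  assumes x: "x \<in> V" and y: "y \<in> V"
  shows "(b x y)\<^sup>2 \<le> b x x * b y y"
proof -
  have poly: "0 \<le> b x x + t * (2 * b x y) + t\<^sup>2 * b y y" for t
  proof -
    have "0 \<le> b (x + sc t y) (x + sc t y)"
      by (rule nonneg) (intro mem x y)
    also have "\<dots> = b x x + t * (2 * b x y) + t\<^sup>2 * b y y"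
      using x y sym[OF x y] by (simp add: expand mem power2_eq_square algebra_simps)
    finally show ?thesis .
  qed
  show ?thesis
  proof (cases "b y y = 0")
    case True
    have "b x y = 0"
    proof (rule ccontr)
      assume n: "b x y \<noteq> 0"
      show False
        \<comment> \<open>for this \<open>t\<close> the linear polynomial takes the value \<open>- 1\<close>\<close>
        using poly[of "- (b x x + 1) / (2 * b x y)"] True n nonneg[OF x] by simp
    qed
    then show ?thesis using True by simp
  next
    case False
    then have pos: "b y y > 0" using nonneg[OF y] by simp
    \<comment> \<open>the value of the polynomial at its minimum\<close>
    have "0 \<le> b x x - (b x y)\<^sup>2 / b y y"
      using poly[of "- b x y / b y y"] pos by (simp add: power2_eq_square field_simps)
    then show ?thesis using pos by (simp add: field_simps)
  qed
qed

lemma Cauchy_Schwarz: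
  assumes "x \<in> V" and "y \<in> V"
  shows "\<bar>b x y\<bar> \<le> sqrt (b x x) * sqrt (b y y)"
  using real_sqrt_le_mono[OF Cauchy_Schwarz_square[OF assms]]
  by (simp add: real_sqrt_mult)

lemma triangle:
  assumes x: "x \<in> V" and y: "y \<in> V"
  shows "sqrt (b (x + y) (x + y)) \<le> sqrt (b x x) + sqrt (b y y)"
proof (rule real_le_lsqrt)
  have "b (x + y) (x + y) = b x x + 2 * b x y + b y y"
    using x y sym[OF x y] by (simp add: expand mem)
  also have "\<dots> \<le> b x x + 2 * (sqrt (b x x) * sqrt (b y y)) + b y y"
    using Cauchy_Schwarz[OF x y] by (simp add: abs_le_iff)
  also have "\<dots> = (sqrt (b x x) + sqrt (b y y))\<^sup>2"
    using nonneg x y by (simp add: power2_sum)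
  finally show "b (x + y) (x + y) \<le> (sqrt (b x x) + sqrt (b y y))\<^sup>2" .
qed (use nonneg x y in simp)

lemma triangle_sum:
  assumes "\<And>i. i \<in> I \<Longrightarrow> f i \<in> V"
  shows "sqrt (b (\<Sum>i\<in>I. f i) (\<Sum>i\<in>I. f i)) \<le> (\<Sum>i\<in>I. sqrt (b (f i) (f i)))"
  using assms
proof (induction I rule: infinite_finite_induct)
  case (insert i F)
  have "sqrt (b (f i + (\<Sum>i\<in>F. f i)) (f i + (\<Sum>i\<in>F. f i)))
      \<le> sqrt (b (f i) (f i)) + sqrt (b (\<Sum>i\<in>F. f i) (\<Sum>i\<in>F. f i))"
    using insert.prems by (intro triangle sum_mem) auto
  also have "sqrt (b (\<Sum>i\<in>F. f i) (\<Sum>i\<in>F. f i)) \<le> (\<Sum>i\<in>F. sqrt (b (f i) (f i)))"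
    using insert.prems by (intro insert.IH) auto
  finally show ?case using insert.hyps by simp
qed (simp_all add: zero_left zero_mem)

lemma sqrt_scale:
  assumes "x \<in> V"
  shows "sqrt (b (sc c x) (sc c x)) = \<bar>c\<bar> * sqrt (b x x)"
proof -
  have "b (sc c x) (sc c x) = c\<^sup>2 * b x x"
    using assms by (simp add: scale_left scale_right scale_mem power2_eq_square)
  then show ?thesis by (simp add: real_sqrt_mult)
qed

lemma restrict:
  assumes "subspace W" and "W \<subseteq> V"
  shows "semi_inner sc W b"
proof
  show "subspace W" by fact
  show "functional_on sc W (\<lambda>x. b x y)" if "y \<in> W" for y
    using functional_on_subset[OF functional assms(2)] that assms(2) by blast
qed (use assms sym nonneg in \<open>auto simp: subset_iff\<close>)

end

text \<open>The kernel of one of the separating functionals has codimension at most one, so the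
  representer on the kernel, supplied by the induction hypothesis, only has to be corrected in
  the direction orthogonal to the kernel.  Separating functionals are used in place of a basis
  because they remain available on every subspace.\<close>

lemma riesz_representation:
  fixes V :: "'v::ab_group_add set"
  assumes "finite I"
    and "semi_inner sc V b"
    and "\<And>v. v \<in> V \<Longrightarrow> b v v = 0 \<Longrightarrow> v = 0"
    and "\<And>i. i \<in> I \<Longrightarrow> functional_on sc V (e i)"
    and "\<And>v. v \<in> V \<Longrightarrow> (\<And>i. i \<in> I \<Longrightarrow> e i v = 0) \<Longrightarrow> v = 0"
    and "functional_on sc V L"
  shows "\<exists>s\<in>V. \<forall>w\<in>V. b s w = L w"
  using assms
proof (induction I arbitrary: V L rule: finite_induct)
  case empty
  interpret semi_inner sc V b by fact
  have 0: "v = 0" if "v \<in> V" for v using empty(4) that by blast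
  have "L 0 = 0" using functional_zero[OF empty(5)] .
  then have "b 0 w = L w" if "w \<in> V" for w using 0[OF that] zero_left[OF zero_mem] by simp
  then show ?case using zero_mem by blast
next
  case (insert i I)
  interpret semi_inner sc V b by fact
  define V0 where "V0 = {v \<in> V. e i v = 0}"
  have ei: "functional_on sc V (e i)" using insert by simp
  have "e i 0 = 0" using functional_zero[OF ei] .
  then have sub: "subspace V0"
    unfolding V0_def subspace_def
    using mem functional_on_add[OF ei] functional_on_scale[OF ei] by auto
  have V0V: "V0 \<subseteq> V" by (auto simp: V0_def)
  have ex0: "\<exists>s\<in>V0. \<forall>w\<in>V0. b s w = L' w" if "functional_on sc V L'" for L'
  proof (rule insert.IH)
    show "semi_inner sc V0 b" by (rule restrict[OF sub V0V])
    show "v = 0" if "v \<in> V0" "b v v = 0" for v using insert.prems(2) that V0V by blast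
    show "functional_on sc V0 (e j)" if "j \<in> I" for j
      using insert.prems(3) that V0V functional_on_subset by blast
    show "v = 0" if "v \<in> V0" "\<And>j. j \<in> I \<Longrightarrow> e j v = 0" for v
      by (rule insert.prems(4)) (use that in \<open>auto simp: V0_def\<close>)
    show "functional_on sc V0 L'" using that V0V functional_on_subset by blast
  qed
  show ?case
  proof (cases "V0 = V")
    case True
    then show ?thesis using ex0[OF insert.prems(5)] by simp
  next
    case False
    then obtain x where x: "x \<in> V" "e i x \<noteq> 0" by (auto simp: V0_def)
    obtain p where p: "p \<in> V0" "\<forall>w\<in>V0. b p w = b x w" using ex0[OF functional_right[OF x(1)]] by blast
    obtain s0 where s0: "s0 \<in> V0" "\<forall>w\<in>V0. b s0 w = L w" using ex0[OF insert.prems(5)] by blast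
    define q where "q = x - p"
    have pV: "p \<in> V" "s0 \<in> V" using p s0 V0V by auto
    have q: "q \<in> V" unfolding q_def by (intro mem x pV)
    have eq: "e i q = e i x"
      using functional_diff[OF ei x(1) pV(1)] p(1) by (simp add: q_def V0_def)
    then have eq0: "e i q \<noteq> 0" using x by simp
    then have "q \<noteq> 0" using \<open>e i 0 = 0\<close> by auto
    then have qq: "b q q \<noteq> 0" using insert.prems(2)[OF q] by blast
    have orth: "b q w = 0" if "w \<in> V0" for w
      using p(2) that V0V pV x by (auto simp: q_def diff_left subset_iff)
    define s where "s = s0 + sc (L q / b q q) q"
    have s: "s \<in> V" unfolding s_def by (intro mem q pV)
    have "b s w = L w" if w: "w \<in> V" for w
    proof -
      define r where "r = e i w / e i q"
      define w0 where "w0 = w - sc r q"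
      have "e i w0 = 0"
        unfolding w0_def using functional_diff[OF ei w scale_mem[OF q]] eq0
        by (simp add: functional_on_scale[OF ei q] r_def)
      then have w0: "w0 \<in> V0" by (simp add: V0_def w0_def mem w q)
      then have w0V: "w0 \<in> V" using V0V by auto
      have w_eq: "w = w0 + sc r q" by (simp add: w0_def)
      have "b s w0 = L w0"
        using s0 w0 w0V pV q orth[OF w0] by (simp add: s_def expand mem)
      moreover have "b s q = L q"
        using pV q qq orth[OF s0(1)] sym[OF pV(2) q] by (simp add: s_def expand mem)
      ultimately have "b s w = L w0 + r * L q"
        by (subst w_eq) (simp add: expand mem s q w0V)
      also have "\<dots> = L w"
        by (subst w_eq)
          (simp add: functional_on_add[OF insert.prems(5)] functional_on_scale[OF insert.prems(5)] mem q w0V)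
      finally show ?thesis .
    qed
    then show ?thesis using s by blast
  qed
qed

section \<open>Energy stability of the leapfrog scheme\<close>

text \<open>Expanding the squares shows that the energy
  \<open>m(d, d) / (2 \<tau>\<^sup>2) - a(d, d) / 8 + a(s, s) / 8\<close> with \<open>d = w - v\<close> and \<open>s = w + v\<close> collapses
  to this form.\<close>

definition leapfrog_energy ::
  "('v::ab_group_add \<Rightarrow> 'v \<Rightarrow> real) \<Rightarrow> ('v \<Rightarrow> 'v \<Rightarrow> real) \<Rightarrow> real \<Rightarrow> 'v \<Rightarrow> 'v \<Rightarrow> real" where
  "leapfrog_energy m a \<tau> v w = m (w - v) (w - v) / (2 * \<tau>\<^sup>2) + a w v / 2"

text \<open>Testing the scheme with \<open>u (n + 1) - u (n - 1)\<close> turns both terms on the left into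
  differences of consecutive energies.  The resulting bound
  \<open>E n - E (n - 1) \<le> c F n (sqrt (E n) + sqrt (E (n - 1)))\<close> becomes additive after division by
  the sum of the roots, whence the square root of the energy grows at most linearly in the data.
  The CFL bound, through \<open>\<theta> < 1\<close>, is what makes the energy control the velocity.\<close>

lemma leapfrog_stability:
  fixes u :: "nat \<Rightarrow> 'v::ab_group_add" and F :: "nat \<Rightarrow> real"
  assumes m: "semi_inner sc V m" and a: "semi_inner sc V a"
    and tau: "0 < \<tau>" and theta: "\<theta> < 1"
    and cfl: "\<And>v. v \<in> V \<Longrightarrow> \<tau>\<^sup>2 / 4 * a v v \<le> \<theta> * m v v"
    and u: "\<And>n. n \<le> N \<Longrightarrow> u n \<in> V"
    and F: "\<And>n. 0 \<le> F n"
    and step: "\<And>n w. 1 \<le> n \<Longrightarrow> n < N \<Longrightarrow> w \<in> V \<Longrightarrow>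
       m (u (n + 1) - sc 2 (u n) + u (n - 1)) w / \<tau>\<^sup>2 + a (u n) w \<le> F n * sqrt (m w w)"
    and n: "n < N"
  shows "(1 - \<theta>) / (2 * \<tau>\<^sup>2) * m (u (Suc n) - u n) (u (Suc n) - u n)
           + a (u (Suc n) + u n) (u (Suc n) + u n) / 8 \<le> leapfrog_energy m a \<tau> (u n) (u (Suc n))"
    and "leapfrog_energy m a \<tau> (u n) (u (Suc n))
           \<le> 2 * leapfrog_energy m a \<tau> (u 0) (u (Suc 0)) + \<tau>\<^sup>2 / (1 - \<theta>) * (\<Sum>k=1..n. F k)\<^sup>2"
proof -
  interpret m: semi_inner sc V m by fact
  interpret a: semi_inner sc V a by fact
  define d where "d n = u (Suc n) - u n" for n
  define En where "En n = leapfrog_energy m a \<tau> (u n) (u (Suc n))" for n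
  define K where "K = \<tau> * sqrt (2 / (1 - \<theta>))"
  have K0: "0 \<le> K" using tau theta by (simp add: K_def)
  have K2: "K\<^sup>2 = \<tau>\<^sup>2 * (2 / (1 - \<theta>))" using theta by (simp add: K_def power_mult_distrib)
  have En: "En n = m (d n) (d n) / (2 * \<tau>\<^sup>2) + a (u (Suc n)) (u n) / 2" for n
    by (simp add: En_def leapfrog_energy_def d_def)
  have d: "d n \<in> V" if "n < N" for n
    using that u by (auto simp: d_def intro!: m.diff_mem)
  have lower: "(1 - \<theta>) / (2 * \<tau>\<^sup>2) * m (d n) (d n) + a (u (Suc n) + u n) (u (Suc n) + u n) / 8 \<le> En n"
    if n: "n < N" for n
  proof -
    have uV: "u n \<in> V" "u (Suc n) \<in> V" using n u by auto
    have "a (u (Suc n) + u n) (u (Suc n) + u n) / 8 - a (d n) (d n) / 8 = a (u (Suc n)) (u n) / 2"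
      using uV a.sym[OF uV] by (simp add: d_def a.expand a.mem field_simps)
    moreover have "a (d n) (d n) / 8 \<le> \<theta> * m (d n) (d n) / (2 * \<tau>\<^sup>2)"
      using cfl[OF d[OF n]] tau by (simp add: field_simps)
    ultimately show ?thesis using En[of n] by (simp add: diff_divide_distrib algebra_simps)
  qed
  show "(1 - \<theta>) / (2 * \<tau>\<^sup>2) * m (u (Suc n) - u n) (u (Suc n) - u n)
           + a (u (Suc n) + u n) (u (Suc n) + u n) / 8 \<le> leapfrog_energy m a \<tau> (u n) (u (Suc n))"
    using lower[OF n] by (simp add: d_def En_def)
  have velocity: "sqrt (m (d n) (d n)) \<le> K * sqrt (En n) \<and> 0 \<le> En n" if n: "n < N" for n
  proof -
    have "0 \<le> a (u (Suc n) + u n) (u (Suc n) + u n)"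
      using n u by (intro a.nonneg a.mem) auto
    then have le: "(1 - \<theta>) / (2 * \<tau>\<^sup>2) * m (d n) (d n) \<le> En n" using lower[OF n] by simp
    have "m (d n) (d n) = (\<tau>\<^sup>2 * (2 / (1 - \<theta>))) * ((1 - \<theta>) / (2 * \<tau>\<^sup>2) * m (d n) (d n))"
      using tau theta by simp
    also have "\<dots> \<le> (\<tau>\<^sup>2 * (2 / (1 - \<theta>))) * En n"
      using le theta by (intro mult_left_mono) auto
    finally have "m (d n) (d n) \<le> K\<^sup>2 * En n" by (simp add: K2)
    then have "sqrt (m (d n) (d n)) \<le> sqrt (K\<^sup>2 * En n)" by simp
    moreover have "0 \<le> (1 - \<theta>) / (2 * \<tau>\<^sup>2) * m (d n) (d n)"
      using theta m.nonneg[OF d[OF n]] by simp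
    ultimately show ?thesis using K0 le by (simp add: real_sqrt_mult)
  qed
  have increment: "sqrt (En (Suc n)) \<le> sqrt (En n) + K / 2 * F (Suc n)" if n: "Suc n < N" for n
  proof -
    define w where "w = u (Suc (Suc n)) - u n"
    have uV: "u n \<in> V" "u (Suc n) \<in> V" "u (Suc (Suc n)) \<in> V" using n u by auto
    have dV: "d n \<in> V" "d (Suc n) \<in> V" using n d by auto
    have w_eq: "w = d (Suc n) + d n" by (simp add: w_def d_def)
    have w: "w \<in> V" unfolding w_def by (intro m.mem uV)
    have second: "u (Suc (Suc n)) - sc 2 (u (Suc n)) + u n = d (Suc n) - d n"
      using m.scale_left_distrib[of 1 1 "u (Suc n)"] by (simp add: d_def)
    have "m (d (Suc n) - d n) w = m (d (Suc n)) (d (Suc n)) - m (d n) (d n)"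
      unfolding w_eq using dV m.sym[OF dV] by (simp add: m.expand m.mem)
    moreover have "a (u (Suc n)) w = a (u (Suc (Suc n))) (u (Suc n)) - a (u (Suc n)) (u n)"
      unfolding w_def using uV a.sym[OF uV(2,3)] by (simp add: a.expand)
    ultimately have "En (Suc n) - En n = (m (d (Suc n) - d n) w / \<tau>\<^sup>2 + a (u (Suc n)) w) / 2"
      unfolding En by (simp add: diff_divide_distrib add_divide_distrib)
    also have "\<dots> \<le> F (Suc n) * sqrt (m w w) / 2"
      using step[of "Suc n" w] n w second by (intro divide_right_mono) simp_all
    also have "\<dots> \<le> F (Suc n) * (sqrt (m (d (Suc n)) (d (Suc n))) + sqrt (m (d n) (d n))) / 2"
      using m.triangle[OF dV(2,1)] F[of "Suc n"] by (simp add: w_eq mult_left_mono)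
    also have "\<dots> \<le> F (Suc n) * (K * sqrt (En (Suc n)) + K * sqrt (En n)) / 2"
      using velocity[of n] velocity[of "Suc n"] n F[of "Suc n"]
      by (intro divide_right_mono mult_left_mono add_mono) auto
    finally have diff: "En (Suc n) - En n \<le> K / 2 * F (Suc n) * (sqrt (En (Suc n)) + sqrt (En n))"
      by (simp add: algebra_simps)
    have pos: "0 \<le> En n" "0 \<le> En (Suc n)" using velocity n by auto
    have fact: "En (Suc n) - En n = (sqrt (En (Suc n)) - sqrt (En n)) * (sqrt (En (Suc n)) + sqrt (En n))"
      using pos by (simp add: algebra_simps)
    show ?thesis
    proof (cases "sqrt (En (Suc n)) + sqrt (En n) = 0")
      case True
      then have "sqrt (En (Suc n)) = 0" using pos by (simp add: add_nonneg_eq_0_iff)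
      then show ?thesis using pos K0 F[of "Suc n"] by simp
    next
      case False
      then have "0 < sqrt (En (Suc n)) + sqrt (En n)"
        using pos by (metis add_nonneg_nonneg less_eq_real_def real_sqrt_ge_zero)
      then have "sqrt (En (Suc n)) - sqrt (En n) \<le> K / 2 * F (Suc n)"
        using diff unfolding fact by (rule mult_right_le_imp_le[rotated])
      then show ?thesis by simp
    qed
  qed
  have growth: "sqrt (En n) \<le> sqrt (En 0) + K / 2 * (\<Sum>k=1..n. F k)" if "n < N" for n
    using that
  proof (induction n)
    case (Suc n)
    then show ?case using increment[of n] by (simp add: algebra_simps)
  qed simp
  have E0: "0 \<le> En 0" "0 \<le> En n" using velocity[of 0] velocity[OF n] n by auto
  have "En n = (sqrt (En n))\<^sup>2" using E0 by simp
  also have "\<dots> \<le> (sqrt (En 0) + K / 2 * (\<Sum>k=1..n. F k))\<^sup>2"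
    using growth[OF n] E0 by (intro power_mono) auto
  also have "\<dots> \<le> 2 * (sqrt (En 0))\<^sup>2 + 2 * (K / 2 * (\<Sum>k=1..n. F k))\<^sup>2"
    using sum_squares_bound[of "sqrt (En 0)" "K / 2 * (\<Sum>k=1..n. F k)"] by (simp add: power2_sum)
  also have "\<dots> = 2 * En 0 + \<tau>\<^sup>2 / (1 - \<theta>) * (\<Sum>k=1..n. F k)\<^sup>2"
    using E0 theta by (simp add: power_mult_distrib power_divide K2 field_simps)
  finally show "leapfrog_energy m a \<tau> (u n) (u (Suc n))
      \<le> 2 * leapfrog_energy m a \<tau> (u 0) (u (Suc 0)) + \<tau>\<^sup>2 / (1 - \<theta>) * (\<Sum>k=1..n. F k)\<^sup>2"
    by (simp add: En_def)
qed

section \<open>The inner product of bounded measurable fields\<close>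

lemmas semi_inner_fieldsI =
  semi_inner.intro[OF fields.vector_space_axioms semi_inner_axioms.intro]

text \<open>On a bounded domain this class contains the piecewise constant fields, is preserved by
  multiplication with the coefficients, and any two members have an integrable product.  One
  class therefore settles all questions of integrability except for the source term.\<close>

definition bounded_fields :: "pt set \<Rightarrow> (pt \<Rightarrow> 'b::euclidean_space) set" where
  "bounded_fields K = {f \<in> borel_measurable (lebesgue_on K). \<exists>B. \<forall>x\<in>K. norm (f x) \<le> B}"

lemma bounded_fieldsI:
  "f \<in> borel_measurable (lebesgue_on K) \<Longrightarrow> (\<And>x. x \<in> K \<Longrightarrow> norm (f x) \<le> B) \<Longrightarrow> f \<in> bounded_fields K"
  by (auto simp: bounded_fields_def)

lemma bounded_fieldsE:
  assumes "f \<in> bounded_fields K"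
  obtains B where "f \<in> borel_measurable (lebesgue_on K)" "0 \<le> B" "\<And>x. x \<in> K \<Longrightarrow> norm (f x) \<le> B"
proof -
  obtain B where B: "\<forall>x\<in>K. norm (f x) \<le> B" using assms by (auto simp: bounded_fields_def)
  show thesis
    by (rule that[of "max 0 B"]) (use assms B in \<open>auto simp: bounded_fields_def le_max_iff_disj\<close>)
qed

lemma bounded_fields_linear:
  fixes T :: "'b::euclidean_space \<Rightarrow> 'c::euclidean_space"
  assumes T: "bounded_linear T" and f: "f \<in> bounded_fields K"
  shows "(\<lambda>x. T (f x)) \<in> bounded_fields K"
proof -
  interpret T: bounded_linear T by fact
  obtain C where C: "0 < C" "\<And>y. norm (T y) \<le> norm y * C" using T.pos_bounded by blast
  obtain B where B: "f \<in> borel_measurable (lebesgue_on K)" "\<And>x. x \<in> K \<Longrightarrow> norm (f x) \<le> B"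
    using f by (rule bounded_fieldsE) blast
  have "T \<in> borel_measurable borel"
    using T.continuous_on[OF continuous_on_id] borel_measurable_continuous_onI by auto
  then have "(\<lambda>x. T (f x)) \<in> borel_measurable (lebesgue_on K)"
    using measurable_compose[OF B(1)] by blast
  moreover have "norm (T (f x)) \<le> B * C" if "x \<in> K" for x
    using C(2)[of "f x"] mult_right_mono[OF B(2)[OF that], of C] C(1) by linarith
  ultimately show ?thesis by (rule bounded_fieldsI)
qed

lemma bounded_fields_times:
  fixes g :: "pt \<Rightarrow> 'b::euclidean_space"
  assumes r: "r \<in> bounded_fields K" and g: "g \<in> bounded_fields K"
  shows "(\<lambda>x. r x *\<^sub>R g x) \<in> bounded_fields K"
proof -
  obtain R where R: "r \<in> borel_measurable (lebesgue_on K)" "0 \<le> R" "\<And>x. x \<in> K \<Longrightarrow> norm (r x) \<le> R"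
    using r by (rule bounded_fieldsE) blast
  obtain B where B: "g \<in> borel_measurable (lebesgue_on K)" "0 \<le> B" "\<And>x. x \<in> K \<Longrightarrow> norm (g x) \<le> B"
    using g by (rule bounded_fieldsE) blast
  show ?thesis
  proof (rule bounded_fieldsI)
    show "(\<lambda>x. r x *\<^sub>R g x) \<in> borel_measurable (lebesgue_on K)"
      using R(1) B(1) by (rule borel_measurable_scaleR)
    show "norm (r x *\<^sub>R g x) \<le> R * B" if "x \<in> K" for x
      using mult_mono[OF R(3)[OF that] B(3)[OF that]] R(2) by simp
  qed
qed

lemma bounded_fields_add:
  assumes "f \<in> bounded_fields K" and "g \<in> bounded_fields K"
  shows "(\<lambda>x. f x + g x) \<in> bounded_fields K"
proof -
  obtain A where A: "f \<in> borel_measurable (lebesgue_on K)" "0 \<le> A" "\<And>x. x \<in> K \<Longrightarrow> norm (f x) \<le> A"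
    using assms(1) by (rule bounded_fieldsE) blast
  obtain B where B: "g \<in> borel_measurable (lebesgue_on K)" "0 \<le> B" "\<And>x. x \<in> K \<Longrightarrow> norm (g x) \<le> B"
    using assms(2) by (rule bounded_fieldsE) blast
  show ?thesis
  proof (rule bounded_fieldsI)
    show "(\<lambda>x. f x + g x) \<in> borel_measurable (lebesgue_on K)"
      using A(1) B(1) by (rule borel_measurable_add)
    show "norm (f x + g x) \<le> A + B" if "x \<in> K" for x
      using norm_triangle_mono[OF A(3)[OF that] B(3)[OF that]] .
  qed
qed

lemma subspace_bounded_fields: "fields.subspace (bounded_fields K)"
  unfolding fields.subspace_def
proof (intro conjI ballI allI)
  show "0 \<in> bounded_fields K"
    by (rule bounded_fieldsI[of _ _ 0]) (auto simp: zero_fun_def)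
  show "f + g \<in> bounded_fields K" if "f \<in> bounded_fields K" "g \<in> bounded_fields K" for f g
    using bounded_fields_add[OF that] by (simp add: plus_fun_def)
  show "fscale c f \<in> bounded_fields K" if "f \<in> bounded_fields K" for c f
    using bounded_fields_linear[OF bounded_linear_scaleR_right that] by (simp add: fscale_def)
qed

lemma ip_eq_integral:
  "K \<in> sets lebesgue \<Longrightarrow> ip K f g = (\<integral>x. f x \<bullet> g x \<partial>lebesgue_on K)"
  by (simp add: ip_def set_lebesgue_integral_def integral_restrict_space)

lemma integrable_inner:
  assumes K: "K \<in> lmeasurable" and f: "f \<in> bounded_fields K" and g: "g \<in> bounded_fields K"
  shows "integrable (lebesgue_on K) (\<lambda>x. f x \<bullet> g x)"
proof -
  obtain A where A: "f \<in> borel_measurable (lebesgue_on K)" "0 \<le> A" "\<And>x. x \<in> K \<Longrightarrow> norm (f x) \<le> A"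
    using f by (rule bounded_fieldsE) blast
  obtain B where B: "g \<in> borel_measurable (lebesgue_on K)" "0 \<le> B" "\<And>x. x \<in> K \<Longrightarrow> norm (g x) \<le> B"
    using g by (rule bounded_fieldsE) blast
  show ?thesis
  proof (rule finite_measure.integrable_const_bound)
    show "finite_measure (lebesgue_on K)" using K by (rule finite_measure_lebesgue_on)
    show "(\<lambda>x. f x \<bullet> g x) \<in> borel_measurable (lebesgue_on K)"
      using A(1) B(1) by (rule borel_measurable_inner)
    show "AE x in lebesgue_on K. norm (f x \<bullet> g x) \<le> A * B"
    proof (rule AE_I2)
      fix x assume "x \<in> space (lebesgue_on K)"
      then have x: "x \<in> K" by simp
      have "norm (f x \<bullet> g x) \<le> norm (f x) * norm (g x)"
        using Cauchy_Schwarz_ineq2[of "f x" "g x"] by simp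
      also have "\<dots> \<le> A * B" using A(2) A(3)[OF x] B(3)[OF x] by (intro mult_mono) auto
      finally show "norm (f x \<bullet> g x) \<le> A * B" .
    qed
  qed
qed

lemma semi_inner_ip:
  assumes K: "K \<in> lmeasurable"
  shows "semi_inner fscale (bounded_fields K) (ip K :: (pt \<Rightarrow> 'b::euclidean_space) \<Rightarrow> _)"
proof (rule semi_inner_fieldsI)
  note eq = ip_eq_integral[OF fmeasurableD[OF K]]
  show "fields.subspace (bounded_fields K :: (pt \<Rightarrow> 'b) set)" by (rule subspace_bounded_fields)
  show "ip K f g = ip K g f" for f g :: "pt \<Rightarrow> 'b" by (simp add: ip_def inner_commute)
  show "0 \<le> ip K f f" for f :: "pt \<Rightarrow> 'b"
    unfolding eq by (rule Bochner_Integration.integral_nonneg) simp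
  show "functional_on fscale (bounded_fields K) (\<lambda>f. ip K f g)"
    if g: "g \<in> bounded_fields K" for g :: "pt \<Rightarrow> 'b"
  proof (rule functional_onI)
    show "ip K (f + f') g = ip K f g + ip K f' g"
      if "f \<in> bounded_fields K" "f' \<in> bounded_fields K" for f f'
      using integrable_inner[OF K that(1) g] integrable_inner[OF K that(2) g]
      by (simp add: eq inner_add_left)
    show "ip K (fscale c f) g = c * ip K f g" for c f
      by (simp add: eq fscale_def)
  qed
qed

lemma negligible_integral_zero:
  fixes g :: "pt \<Rightarrow> real"
  assumes K: "K \<in> sets lebesgue" and g: "integrable (lebesgue_on K) g"
    and nonneg: "\<And>x. x \<in> K \<Longrightarrow> 0 \<le> g x" and zero: "(\<integral>x. g x \<partial>lebesgue_on K) = 0"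
  shows "negligible {x \<in> K. g x \<noteq> 0}"
proof -
  have "AE x in lebesgue_on K. 0 \<le> g x"
    by (rule AE_I2) (simp add: nonneg)
  then have "AE x in lebesgue_on K. g x = 0"
    using integral_nonneg_eq_0_iff_AE[OF g] zero by simp
  then have "AE x in lebesgue. x \<in> K \<longrightarrow> g x = 0"
    using K by (subst (asm) AE_restrict_space_iff) auto
  then obtain N where N: "{x. \<not> (x \<in> K \<longrightarrow> g x = 0)} \<subseteq> N" "N \<in> null_sets lebesgue"
    by (auto elim!: AE_E simp: null_sets_def)
  have "{x \<in> K. g x \<noteq> 0} \<subseteq> N" using N(1) by auto
  then show ?thesis using N(2) negligible_subset negligible_iff_null_sets by blast
qed

section \<open>Piecewise constant fields\<close>

lemma subspace_piecewise_const: "fields.subspace (piecewise_const \<P> :: (pt \<Rightarrow> 'b::real_vector) set)"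
  unfolding fields.subspace_def piecewise_const_def fscale_def plus_fun_def zero_fun_def
  by (auto, metis+)

lemma piecewise_const_bounded:
  fixes f :: "pt \<Rightarrow> 'b::euclidean_space"
  assumes fin: "finite \<P>" and op: "\<And>A. A \<in> \<P> \<Longrightarrow> open A" and f: "f \<in> piecewise_const \<P>"
  shows "f \<in> bounded_fields K"
proof -
  have const: "\<exists>c. \<forall>x\<in>A. f x = c" if "A \<in> \<P>" for A
    using f that by (auto simp: piecewise_const_def)
  have off: "f x = 0" if "x \<notin> \<Union>\<P>" for x
    using f that by (simp add: piecewise_const_def)
  obtain c where c: "\<And>A x. A \<in> \<P> \<Longrightarrow> x \<in> A \<Longrightarrow> f x = c A"
    using const by metis
  have range: "range f \<subseteq> insert 0 (c ` \<P>)"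
  proof
    fix y assume "y \<in> range f"
    then obtain x where y: "y = f x" by blast
    show "y \<in> insert 0 (c ` \<P>)"
    proof (cases "x \<in> \<Union>\<P>")
      case True
      then show ?thesis using c y by auto
    next
      case False
      then show ?thesis using off y by simp
    qed
  qed
  then have fin_range: "finite (range f)" using fin by (meson finite_imageI finite_insert finite_subset)
  have "simple_function lebesgue f"
    unfolding simple_function_def
  proof (intro conjI ballI)
    show "finite (f ` space lebesgue)" using fin_range by simp
    fix y
    have "f -` {y} \<inter> space lebesgue
        = \<Union>{A \<in> \<P>. \<exists>x\<in>A. f x = y} \<union> (if y = 0 then - \<Union>\<P> else {})" (is "_ = ?R")
    proof (intro set_eqI iffI)
      fix x assume "x \<in> f -` {y} \<inter> space lebesgue"
      then show "x \<in> ?R" using off[of x] by (cases "x \<in> \<Union>\<P>") auto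
    next
      fix x assume x: "x \<in> ?R"
      show "x \<in> f -` {y} \<inter> space lebesgue"
        using x c off[of x] by (auto split: if_splits)
    qed
    also have "\<dots> \<in> sets lebesgue"
    proof -
      have "open (\<Union>{A \<in> \<P>. \<exists>x\<in>A. f x = y})" "closed (- \<Union>\<P>)" using op by auto
      then show ?thesis by (auto intro: sets.Un borel_open borel_closed)
    qed
    finally show "f -` {y} \<inter> space lebesgue \<in> sets lebesgue" .
  qed
  then have "f \<in> borel_measurable lebesgue" by (rule borel_measurable_simple_function)
  then have meas: "f \<in> borel_measurable (lebesgue_on K)" by (rule measurable_restrict_space1)
  have "bounded (range f)" using fin_range by (rule finite_imp_bounded)
  then obtain B where "\<And>x. norm (f x) \<le> B" by (auto simp: bounded_iff)
  then show ?thesis using meas by (intro bounded_fieldsI)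
qed

text \<open>The pieces are open and meet \<open>K\<close>, so a nonzero value would be taken on a set of positive
  measure.  This is what makes the \<open>L\<^sup>2\<close> product definite on fields as functions, and thereby
  makes the operators defined by definite description exist.\<close>

lemma piecewise_const_eq_0:
  fixes f :: "pt \<Rightarrow> 'b::real_normed_vector"
  assumes f: "f \<in> piecewise_const \<P>" and op: "\<And>A. A \<in> \<P> \<Longrightarrow> open A"
    and meet: "\<And>A. A \<in> \<P> \<Longrightarrow> A \<noteq> {} \<Longrightarrow> A \<inter> K \<noteq> {}" and K: "open K"
    and neg: "negligible {x \<in> K. f x \<noteq> 0}"
  shows "f = 0"
proof (rule ext)
  fix x
  have "f x = 0"
  proof (rule ccontr)
    assume nz: "f x \<noteq> 0"
    then obtain A where A: "A \<in> \<P>" "x \<in> A" using f unfolding piecewise_const_def by blast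
    then obtain c where c: "\<forall>y\<in>A. f y = c" using f unfolding piecewise_const_def by blast
    have "A \<inter> K \<subseteq> {x \<in> K. f x \<noteq> 0}" using c A(2) nz by auto
    then have "negligible (A \<inter> K)" using neg negligible_subset by blast
    moreover have "open (A \<inter> K)" "A \<inter> K \<noteq> {}" using op A K meet by auto
    ultimately show False using open_not_negligible by blast
  qed
  then show "f x = 0 x" by simp
qed

section \<open>Geometry of the meshes\<close>

lemma path_image_boundary: "path_image (boundary_path Q) = \<Union>(sides Q)"
  by (cases Q) (simp add: path_image_join Un_assoc)

lemma compact_boundary: "compact (path_image (boundary_path Q))"
  by (cases Q) (simp add: compact_path_image)

lemma open_cell: "open (cell Q)"
  unfolding cell_def by (intro open_inside compact_imp_closed compact_boundary)

lemma cell_Int_boundary: "cell Q \<inter> \<Union>(sides Q) = {}"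
  unfolding cell_def path_image_boundary[symmetric] by (rule inside_no_overlap)

lemma bounded_region: "bounded (region Q)"
  unfolding region_def cell_def
  using compact_imp_bounded[OF compact_boundary] by (simp add: bounded_inside)

lemma corners_subset_boundary: "corners Q \<subseteq> \<Union>(sides Q)"
  by (cases Q) auto

lemma corners_subset_region: "corners Q \<subseteq> region Q"
  using corners_subset_boundary by (auto simp: region_def path_image_boundary)

text \<open>A point outside \<open>T\<close> lies in an unbounded component of the complement of \<open>T\<close>.  That
  component stays away from \<open>S\<close>, so the point is also outside \<open>S\<close>.  This places a subcell inside
  its macro-element as soon as the boundary of the subcell is there.\<close>

lemma inside_mono_filled:
  assumes "S \<subseteq> inside T \<union> T"
  shows "inside S \<subseteq> inside T \<union> T"
proof
  fix x assume x: "x \<in> inside S"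
  show "x \<in> inside T \<union> T"
  proof (rule ccontr)
    assume "x \<notin> inside T \<union> T"
    then have out: "x \<in> outside T" using inside_Un_outside[of T] by blast
    let ?C = "connected_component_set (- T) x"
    have "?C \<subseteq> outside T" using outside_same_component[OF _ out] by auto
    then have "?C \<subseteq> - S" using assms outside_no_overlap inside_Int_outside by blast
    moreover have "x \<in> ?C" using out by (auto simp: outside_def connected_component_refl)
    ultimately have "?C \<subseteq> connected_component_set (- S) x"
      by (intro connected_component_maximal connected_connected_component)
    then have "bounded ?C" using x bounded_subset by (auto simp: inside_def)
    then show False using out by (auto simp: outside_def)
  qed
qed

lemma half_side_subset:
  "closed_segment a (midpoint a b) \<subseteq> closed_segment a b"
  "closed_segment b (midpoint a b) \<subseteq> closed_segment a b"
  by (auto simp: subset_closed_segment midpoint_sym closed_segment_commute)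

lemma subcell_subset_region:
  assumes E: "E \<in> subcells M z" and z: "z \<in> cell M"
    and dual: "\<forall>(z', m)\<in>dual_edges M z. open_segment z' m \<subseteq> cell M"
  shows "cell E \<subseteq> region M"
proof -
  obtain a b c d where M: "M = Quad a b c d" by (cases M)
  have mid: "closed_segment z (midpoint p q) \<subseteq> region M"
    if "closed_segment p q \<in> sides M" "(z, midpoint p q) \<in> dual_edges M z" for p q
  proof -
    have "open_segment z (midpoint p q) \<subseteq> region M"
      using dual that(2) by (auto simp: region_def)
    moreover have "z \<in> region M" using z by (simp add: region_def)
    moreover have "midpoint p q \<in> region M"
      using that(1) UnionI[of "closed_segment p q" "sides M" "midpoint p q"]
      by (simp add: region_def path_image_boundary)
    ultimately show ?thesis by (auto simp: open_segment_def)
  qed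
  have mids: "closed_segment z (midpoint a b) \<subseteq> region M" "closed_segment z (midpoint b c) \<subseteq> region M"
    "closed_segment z (midpoint c d) \<subseteq> region M" "closed_segment z (midpoint d a) \<subseteq> region M"
    by (rule mid; simp add: M)+
  have half: "closed_segment p (midpoint p q) \<subseteq> region M \<and> closed_segment q (midpoint p q) \<subseteq> region M"
    if "closed_segment p q \<in> sides M" for p q
    using half_side_subset[where a = p and b = q] that by (auto simp: region_def path_image_boundary)
  have halves: "closed_segment a (midpoint a b) \<subseteq> region M \<and> closed_segment b (midpoint a b) \<subseteq> region M"
    "closed_segment b (midpoint b c) \<subseteq> region M \<and> closed_segment c (midpoint b c) \<subseteq> region M"
    "closed_segment c (midpoint c d) \<subseteq> region M \<and> closed_segment d (midpoint c d) \<subseteq> region M"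
    "closed_segment d (midpoint d a) \<subseteq> region M \<and> closed_segment a (midpoint d a) \<subseteq> region M"
    by (rule half; simp add: M)+
  have "E = Quad a (midpoint a b) z (midpoint d a) \<or> E = Quad b (midpoint b c) z (midpoint a b) \<or>
      E = Quad c (midpoint c d) z (midpoint b c) \<or> E = Quad d (midpoint d a) z (midpoint c d)"
    using E by (simp add: M)
  then have "\<Union>(sides E) \<subseteq> region M"
    by (elim disjE) (use halves mids in \<open>simp_all add: closed_segment_commute midpoint_sym\<close>)
  then show ?thesis
    using inside_mono_filled[of "\<Union>(sides E)" "path_image (boundary_path M)"]
    by (simp add: cell_def region_def path_image_boundary)
qed

lemma cell_Int_region:
  assumes T: "quad_partition Om T" and Q: "Q \<in> T" "Q' \<in> T" "Q \<noteq> Q'"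
  shows "cell Q \<inter> region Q' = {}"
proof -
  have "region Q \<inter> region Q' \<subseteq> \<Union>(sides Q \<inter> sides Q') \<union> (corners Q \<inter> corners Q')"
    using T Q by (auto simp: quad_partition_def conforming_def)
  also have "\<dots> \<subseteq> \<Union>(sides Q)" using corners_subset_boundary by auto
  finally show ?thesis using cell_Int_boundary[of Q] by (auto simp: region_def)
qed

lemma negligible_region_Int:
  assumes T: "quad_partition Om T" and Q: "Q \<in> T" "Q' \<in> T" "Q \<noteq> Q'"
  shows "negligible (region Q \<inter> region Q')"
proof (rule negligible_subset)
  have "region Q \<inter> region Q' \<subseteq> \<Union>(sides Q \<inter> sides Q') \<union> (corners Q \<inter> corners Q')"
    using T Q by (auto simp: quad_partition_def conforming_def)
  then show "region Q \<inter> region Q' \<subseteq> \<Union>(sides Q) \<union> corners Q" by blast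
  have "negligible s" if s: "s \<in> sides Q" for s
  proof -
    obtain p q where "s = closed_segment p q" using s by (cases Q) auto
    then show ?thesis by (simp add: negligible_convex_interior interior_closed_segment_ge2)
  qed
  moreover have "finite (sides Q)" "finite (corners Q)" by (cases Q; simp)+
  ultimately show "negligible (\<Union>(sides Q) \<union> corners Q)"
    by (simp add: negligible_Union negligible_finite)
qed

lemma diameter_region_pos:
  assumes "is_quadrilateral Q"
  shows "0 < diameter (region Q)"
proof -
  obtain a b c d where Q: "Q = Quad a b c d" by (cases Q)
  have "a \<noteq> b" using assms by (auto simp: Q)
  moreover have "a \<in> region Q" "b \<in> region Q" using corners_subset_region[of Q] by (auto simp: Q)
  ultimately show ?thesis
    using diameter_bounded_bound[OF bounded_region[of Q], of a b] zero_less_dist_iff[of a b] by linarith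
qed

locale fine_mesh =
  fixes P :: "'z fine_problem_scheme"
  assumes fine: "fine_discretization P"
begin

lemma domain: "open (Dom P)" "bounded (Dom P)" "Dom P \<noteq> {}" "Dom P \<in> lmeasurable"
  using fine by (auto simp: fine_discretization_def polygonal_domain_def intro: lmeasurable_open)

lemma macro_partition: "quad_partition (Dom P) (macros P)"
  using fine by (simp add: fine_discretization_def)

lemma finite_macros: "finite (macros P)"
  using macro_partition by (simp add: quad_partition_def)

lemma macro_region_subset: "M \<in> macros P \<Longrightarrow> region M \<subseteq> closure (Dom P)"
  using macro_partition by (auto simp: quad_partition_def)

lemma centre: "M \<in> macros P \<Longrightarrow> centre P M \<in> cell M"
  "M \<in> macros P \<Longrightarrow> \<forall>(z, m)\<in>dual_edges M (centre P M). open_segment z m \<subseteq> cell M"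
  using fine by (simp_all add: fine_discretization_def)

lemma finite_fine_cells: "finite (fine_cells P)"
proof -
  have "finite (subcells M z)" for M z by (cases M) simp
  then show ?thesis by (simp add: fine_cells_def finite_macros)
qed

text \<open>A subcell missing the domain would carry stresses that no integral over the domain sees.
  It is excluded because the subcell lies in its macro-element, hence in the closure of the
  domain, and an open set that meets the closure meets the set.\<close>

lemma fine_cell_meets_domain:
  assumes E: "E \<in> fine_cells P" and ne: "cell E \<noteq> {}"
  shows "cell E \<inter> Dom P \<noteq> {}"
proof -
  obtain M where M: "M \<in> macros P" "E \<in> subcells M (centre P M)"
    using E by (auto simp: fine_cells_def)
  have "cell E \<subseteq> closure (Dom P)"
    using subcell_subset_region[OF M(2) centre[OF M(1)]] macro_region_subset[OF M(1)] by simp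
  then show ?thesis using ne open_Int_closure_eq_empty[OF open_cell[of E], of "Dom P"] by blast
qed

lemma macro_cell_dichotomy:
  assumes S: "S \<subseteq> macros P" and M: "M \<in> macros P"
  shows "cell M \<subseteq> (\<Union>M'\<in>S. region M') \<or> cell M \<inter> (\<Union>M'\<in>S. region M') = {}"
proof (cases "M \<in> S")
  case True
  then show ?thesis by (auto simp: region_def)
next
  case False
  then show ?thesis using cell_Int_region[OF macro_partition M] S by blast
qed

text \<open>Cutting off at the boundary of a union of macro-elements cuts no macro-element.\<close>

lemma U_on_subset:
  assumes S: "S \<subseteq> macros P"
  shows "U_on P (\<Union>M'\<in>S. region M') \<subseteq> U_h P"
proof
  let ?K = "\<Union>M'\<in>S. region M'"
  fix v assume "v \<in> U_on P ?K"
  then obtain u where u: "u \<in> U_h P" "v = restr ?K u" by (auto simp: U_on_def)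
  have "\<exists>c. \<forall>x\<in>cell M. v x = c" if M: "M \<in> macros P" for M
  proof -
    obtain c where c: "\<forall>x\<in>cell M. u x = c"
      using u(1) M unfolding U_h_def piecewise_const_def by blast
    show ?thesis
    proof (cases "cell M \<subseteq> ?K")
      case True
      then have "\<forall>x\<in>cell M. v x = c" using c u(2) by (auto simp: restr_def)
      then show ?thesis ..
    next
      case False
      then have "\<forall>x\<in>cell M. v x = 0"
        using macro_cell_dichotomy[OF S M] u(2) by (auto simp: restr_def)
      then show ?thesis ..
    qed
  qed
  moreover have "v x = 0" if "x \<notin> \<Union>(cell ` macros P)" for x
    using u that by (auto simp: U_h_def piecewise_const_def restr_def)
  ultimately show "v \<in> U_h P" unfolding U_h_def piecewise_const_def by blast
qed

end

section \<open>The stress space and its two inner products\<close>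

context fine_mesh
begin

lemmas L2 = semi_inner_ip[OF domain(4)]

lemma coefficients:
  obtains c C where "0 < c" and
    "\<And>x. x \<in> Dom P \<Longrightarrow> c \<le> rho P x" "\<And>x. x \<in> Dom P \<Longrightarrow> rho P x \<le> C"
    "\<And>x. x \<in> Dom P \<Longrightarrow> c \<le> lame_mu P x" "\<And>x. x \<in> Dom P \<Longrightarrow> lame_mu P x \<le> C"
    "\<And>x. x \<in> Dom P \<Longrightarrow> c \<le> lame_lambda P x + lame_mu P x" "\<And>x. x \<in> Dom P \<Longrightarrow> \<bar>lame_lambda P x\<bar> \<le> C"
proof -
  have "\<exists>c C. 0 < c \<and> (\<forall>x\<in>Dom P.
        c \<le> rho P x \<and> rho P x \<le> C \<and> c \<le> lame_mu P x \<and> lame_mu P x \<le> C \<and>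
        c \<le> lame_lambda P x + lame_mu P x \<and> \<bar>lame_lambda P x\<bar> \<le> C)"
    using fine by (simp add: fine_discretization_def)
  then obtain c C where cC: "0 < c" "\<forall>x\<in>Dom P.
        c \<le> rho P x \<and> rho P x \<le> C \<and> c \<le> lame_mu P x \<and> lame_mu P x \<le> C \<and>
        c \<le> lame_lambda P x + lame_mu P x \<and> \<bar>lame_lambda P x\<bar> \<le> C" by blast
  show thesis by (rule that[of c C]) (use cC in auto)
qed

lemma coefficients_measurable:
  "rho P \<in> borel_measurable (lebesgue_on (Dom P))"
  "lame_lambda P \<in> borel_measurable (lebesgue_on (Dom P))"
  "lame_mu P \<in> borel_measurable (lebesgue_on (Dom P))"
  using fine by (simp_all add: fine_discretization_def)

lemma rho_pos: "x \<in> Dom P \<Longrightarrow> 0 < rho P x"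
  by (metis coefficients less_le_trans)

lemma rho_bounded: "rho P \<in> bounded_fields (Dom P)"
proof -
  obtain c C where c: "0 < c" and l: "\<And>x. x \<in> Dom P \<Longrightarrow> c \<le> rho P x"
    and u: "\<And>x. x \<in> Dom P \<Longrightarrow> rho P x \<le> C"
    by (rule coefficients) blast
  show ?thesis
  proof (rule bounded_fieldsI)
    show "norm (rho P x) \<le> C" if "x \<in> Dom P" for x
      using c l[OF that] u[OF that] by simp
  qed (rule coefficients_measurable)
qed

lemma semi_inner_rho:
  "semi_inner fscale (bounded_fields (Dom P)) (ip_rho P (Dom P))"
proof -
  interpret L: semi_inner fscale "bounded_fields (Dom P) :: (pt \<Rightarrow> pt) set" "ip (Dom P)"
    by (rule L2)
  have w: "(\<lambda>x. rho P x *\<^sub>R v x) \<in> bounded_fields (Dom P)" if "v \<in> bounded_fields (Dom P)"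
    for v :: "pt \<Rightarrow> pt"
    by (rule bounded_fields_times[OF rho_bounded that])
  show ?thesis
  proof (rule semi_inner_fieldsI)
    show "ip_rho P (Dom P) f g = ip_rho P (Dom P) g f" for f g
      by (simp add: ip_rho_def ip_def inner_commute)
    show "0 \<le> ip_rho P (Dom P) f f" for f
      unfolding ip_rho_def ip_eq_integral[OF fmeasurableD[OF domain(4)]]
    proof (rule Bochner_Integration.integral_nonneg)
      fix x assume "x \<in> space (lebesgue_on (Dom P))"
      then show "0 \<le> (rho P x *\<^sub>R f x) \<bullet> f x" using rho_pos[of x] by simp
    qed
    show "functional_on fscale (bounded_fields (Dom P)) (\<lambda>f. ip_rho P (Dom P) f g)"
      if g: "g \<in> bounded_fields (Dom P)" for g
    proof (rule functional_onI)
      fix f f' :: "pt \<Rightarrow> pt"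
      assume f: "f \<in> bounded_fields (Dom P)" and f': "f' \<in> bounded_fields (Dom P)"
      have "(\<lambda>x. rho P x *\<^sub>R (f + f') x) = (\<lambda>x. rho P x *\<^sub>R f x) + (\<lambda>x. rho P x *\<^sub>R f' x)"
        by (simp add: fun_eq_iff scaleR_add_right)
      then show "ip_rho P (Dom P) (f + f') g = ip_rho P (Dom P) f g + ip_rho P (Dom P) f' g"
        unfolding ip_rho_def using L.add_left[OF w[OF f] w[OF f'] g] by metis
    next
      fix c and f :: "pt \<Rightarrow> pt"
      assume f: "f \<in> bounded_fields (Dom P)"
      have "(\<lambda>x. rho P x *\<^sub>R fscale c f x) = fscale c (\<lambda>x. rho P x *\<^sub>R f x)"
        by (simp add: fun_eq_iff fscale_def)
      then show "ip_rho P (Dom P) (fscale c f) g = c * ip_rho P (Dom P) f g"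
        unfolding ip_rho_def using L.scale_left[OF w[OF f] g] by metis
    qed
  qed (rule subspace_bounded_fields)
qed

lemma subspace_U_h: "fields.subspace (U_h P)"
  unfolding U_h_def by (rule subspace_piecewise_const)

lemma U_h_bounded: "U_h P \<subseteq> bounded_fields K"
  unfolding U_h_def using piecewise_const_bounded finite_macros open_cell by blast

definition stresses :: "(pt \<Rightarrow> mat2) set" where
  "stresses = Sigma_on P (Dom P)"

text \<open>The pair of subcells chosen in the jump depends on the edge alone, so the jump is linear in
  the stress whatever the choice.\<close>

lemma normal_jump_add: "normal_jump P (w + w') e = normal_jump P w e + normal_jump P w' e"
  unfolding normal_jump_def
  by (simp add: Let_def split_beta cell_value_def matrix_vector_mult_diff_rdistrib
      matrix_vector_mult_add_rdistrib)

lemma normal_jump_scale: "normal_jump P (fscale c w) e = c *\<^sub>R normal_jump P w e"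
  unfolding normal_jump_def
  by (simp add: Let_def split_beta cell_value_def fscale_def scaleR_matrix_vector_assoc scaleR_diff_right)

lemma normal_jump_zero: "normal_jump P 0 e = 0"
  unfolding normal_jump_def by (simp add: Let_def split_beta cell_value_def)

lemma subspace_stresses: "fields.subspace stresses"
proof -
  have pc: "fields.subspace (piecewise_const (cell ` fine_cells P) :: (pt \<Rightarrow> mat2) set)"
    by (rule subspace_piecewise_const)
  show ?thesis
    unfolding fields.subspace_def stresses_def Sigma_on_def Sigma_h_def
    using fields.subspace_0[OF pc] fields.subspace_add[OF pc] fields.subspace_scale[OF pc]
    by (auto simp: normal_jump_add normal_jump_scale normal_jump_zero) (simp_all add: fscale_def)
qed

lemma stresses_piecewise: "stresses \<subseteq> piecewise_const (cell ` fine_cells P)"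
  by (auto simp: stresses_def Sigma_on_def Sigma_h_def)

lemma stresses_bounded: "stresses \<subseteq> bounded_fields K"
proof
  fix w assume "w \<in> stresses"
  then have "w \<in> piecewise_const (cell ` fine_cells P)" using stresses_piecewise by blast
  then show "w \<in> bounded_fields K"
    using piecewise_const_bounded[of "cell ` fine_cells P"] finite_fine_cells open_cell by blast
qed

lemma stress_eq_0:
  assumes w: "w \<in> stresses" and neg: "negligible {x \<in> Dom P. w x \<noteq> 0}"
  shows "w = 0"
proof (rule piecewise_const_eq_0)
  show "w \<in> piecewise_const (cell ` fine_cells P)" using w stresses_piecewise by blast
  show "A \<inter> Dom P \<noteq> {}" if "A \<in> cell ` fine_cells P" "A \<noteq> {}" for A
    using that fine_cell_meets_domain by blast
qed (use neg domain open_cell in auto)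

text \<open>A stress is determined by the finitely many entries of its values on the subcells; these are
  the separating functionals.  Stating the result for subspaces \<open>W\<close> covers both the whole stress
  space and the space of skew stresses.\<close>

lemma stress_riesz:
  assumes W: "fields.subspace W" "W \<subseteq> stresses" and b: "semi_inner fscale W b"
    and def: "\<And>w. w \<in> W \<Longrightarrow> b w w = 0 \<Longrightarrow> w = 0" and L: "functional_on fscale W L"
  shows "\<exists>s\<in>W. \<forall>w\<in>W. b s w = L w"
proof (rule riesz_representation[where e = "\<lambda>(E, i, j) w. cell_value w E $ i $ j"
      and I = "fine_cells P \<times> (UNIV :: (2 \<times> 2) set)"])
  show "finite (fine_cells P \<times> (UNIV :: (2 \<times> 2) set))" by (simp add: finite_fine_cells)
  show "functional_on fscale W (case q of (E, i, j) \<Rightarrow> \<lambda>w. cell_value w E $ i $ j)" for q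
    by (cases q) (simp add: functional_on_def cell_value_def fscale_def)
  fix w
  assume w: "w \<in> W"
    and 0: "\<And>q. q \<in> fine_cells P \<times> (UNIV :: (2 \<times> 2) set) \<Longrightarrow>
        (case q of (E, i, j) \<Rightarrow> \<lambda>w. cell_value w E $ i $ j) w = 0"
  have pc: "w \<in> piecewise_const (cell ` fine_cells P)" using w W(2) stresses_piecewise by blast
  show "w = 0"
  proof (rule ext)
    fix x
    have "w x = 0"
    proof (rule ccontr)
      assume nz: "w x \<noteq> 0"
      then obtain E where E: "E \<in> fine_cells P" "x \<in> cell E"
        using pc unfolding piecewise_const_def by blast
      then obtain c where c: "\<forall>y\<in>cell E. w y = c" using pc unfolding piecewise_const_def by blast
      have "(SOME y. y \<in> cell E) \<in> cell E" using E(2) by (rule someI)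
      then have "cell_value w E = w x" using c E(2) by (simp add: cell_value_def)
      moreover have "cell_value w E $ i $ j = 0" for i j using 0[of "(E, i, j)"] E(1) by simp
      ultimately show False using nz by (simp add: vec_eq_iff)
    qed
    then show "w x = 0 x" by simp
  qed
qed (use b def L in auto)

lemma semi_inner_stress: "semi_inner fscale stresses (ip (Dom P))"
  by (rule semi_inner.restrict[OF L2 subspace_stresses stresses_bounded])

lemma stress_definite:
  assumes w: "w \<in> stresses" and 0: "ip (Dom P) w w = 0"
  shows "w = 0"
proof (rule stress_eq_0[OF w])
  have wb: "w \<in> bounded_fields (Dom P)" using w stresses_bounded by blast
  have "negligible {x \<in> Dom P. w x \<bullet> w x \<noteq> 0}"
    by (rule negligible_integral_zero[OF _ integrable_inner[OF domain(4) wb wb]])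
      (use 0 domain(4) ip_eq_integral[of "Dom P" w w] in auto)
  then show "negligible {x \<in> Dom P. w x \<noteq> 0}" by simp
qed

lemma stress_unique:
  assumes s: "s \<in> stresses" "s' \<in> stresses"
    and eq: "\<And>w. w \<in> stresses \<Longrightarrow> ip (Dom P) s w = ip (Dom P) s' w"
  shows "s = s'"
proof -
  interpret S: semi_inner fscale stresses "ip (Dom P)" by (rule semi_inner_stress)
  have d: "s - s' \<in> stresses" by (rule S.diff_mem[OF s])
  have "ip (Dom P) (s - s') (s - s') = 0" using S.diff_left[OF s d] eq[OF d] by simp
  then have "s - s' = 0" using stress_definite[OF d] by blast
  then show ?thesis by simp
qed

lemma representer:
  assumes L: "functional_on fscale stresses L"
  shows "representer P (Dom P) L \<in> stresses"
    and "w \<in> stresses \<Longrightarrow> ip (Dom P) (representer P (Dom P) L) w = L w"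
proof -
  have "\<exists>s\<in>stresses. \<forall>w\<in>stresses. ip (Dom P) s w = L w"
    using stress_riesz[OF subspace_stresses order_refl semi_inner_stress stress_definite L] .
  then have "\<exists>!s. s \<in> stresses \<and> (\<forall>w\<in>stresses. ip (Dom P) s w = L w)"
    using stress_unique by metis
  from theI'[OF this]
  show "representer P (Dom P) L \<in> stresses"
    and "w \<in> stresses \<Longrightarrow> ip (Dom P) (representer P (Dom P) L) w = L w"
    unfolding representer_def stresses_def[symmetric] by blast+
qed

definition compliance_ip :: "(pt \<Rightarrow> mat2) \<Rightarrow> (pt \<Rightarrow> mat2) \<Rightarrow> real" where
  "compliance_ip s t = ip (Dom P) (compliance P s) t"

lemma mat_1_inner: "mat 1 \<bullet> (A :: mat2) = trace A"
  by (simp add: inner_vec_def mat_def trace_def sum_2)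

lemma trace_square_le: "(trace (A :: mat2))\<^sup>2 \<le> 2 * (A \<bullet> A)"
proof -
  have "2 * (A \<bullet> A) - (trace A)\<^sup>2
      = (A $ 1 $ 1 - A $ 2 $ 2)\<^sup>2 + 2 * (A $ 1 $ 2)\<^sup>2 + 2 * (A $ 2 $ 1)\<^sup>2"
    by (simp add: inner_vec_def trace_def sum_2 power2_eq_square algebra_simps)
  then show ?thesis by (smt (verit) zero_le_power2)
qed

lemma compliance_inner:
  "compliance P s x \<bullet> t x = 1 / (2 * lame_mu P x) *
     (s x \<bullet> t x - lame_lambda P x / (2 * lame_lambda P x + 2 * lame_mu P x) * trace (s x) * trace (t x))"
  by (simp add: compliance_def inner_diff_left mat_1_inner)

text \<open>In two dimensions \<open>(tr t)\<^sup>2 \<le> 2 |t|\<^sup>2\<close>, so for \<open>\<lambda> > 0\<close> the trace term takes away at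
  most the fraction \<open>\<lambda> / (\<lambda> + \<mu>) < 1\<close> of \<open>|t|\<^sup>2\<close>; for \<open>\<lambda> \<le> 0\<close> it only adds.\<close>

lemma compliance_pos:
  assumes x: "x \<in> Dom P" and t: "t x \<noteq> 0"
  shows "0 < compliance P t x \<bullet> t x"
proof -
  obtain c where c: "0 < c" "\<And>x. x \<in> Dom P \<Longrightarrow> c \<le> lame_mu P x"
    "\<And>x. x \<in> Dom P \<Longrightarrow> c \<le> lame_lambda P x + lame_mu P x"
    by (rule coefficients) blast
  define l m where "l = lame_lambda P x" and "m = lame_mu P x"
  have lm: "0 < m" "0 < l + m" using c x by (auto simp: l_def m_def intro: less_le_trans)
  have N: "0 < t x \<bullet> t x" using t by simp
  have "l / (2 * l + 2 * m) * (trace (t x))\<^sup>2 < t x \<bullet> t x"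
  proof (cases "l \<le> 0")
    case True
    then have "l / (2 * l + 2 * m) \<le> 0" using lm by (simp add: divide_nonpos_pos)
    then have "l / (2 * l + 2 * m) * (trace (t x))\<^sup>2 \<le> 0" by (rule mult_nonpos_nonneg) simp
    then show ?thesis using N by linarith
  next
    case False
    then have "l / (2 * l + 2 * m) * (trace (t x))\<^sup>2 \<le> l / (2 * l + 2 * m) * (2 * (t x \<bullet> t x))"
      using lm trace_square_le by (intro mult_left_mono) auto
    also have "\<dots> = l / (l + m) * (t x \<bullet> t x)" using lm by (simp add: field_simps)
    also have "\<dots> < 1 * (t x \<bullet> t x)"
      using lm False N by (intro mult_strict_right_mono) auto
    finally show ?thesis by simp
  qed
  then show ?thesis
    unfolding compliance_inner using lm by (simp add: l_def m_def power2_eq_square mult.assoc)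
qed

lemma compliance_add: "compliance P (s + t) = compliance P s + compliance P t"
proof
  fix x
  have "trace (s x + t x) = trace (s x) + trace (t x)" by (simp add: trace_def sum.distrib)
  then show "compliance P (s + t) x = (compliance P s + compliance P t) x"
    by (simp add: compliance_def algebra_simps add_divide_distrib)
qed

lemma compliance_scale: "compliance P (fscale c s) = fscale c (compliance P s)"
proof
  fix x
  have "trace (c *\<^sub>R s x) = c * trace (s x)" by (simp add: trace_def sum_distrib_left)
  then show "compliance P (fscale c s) x = fscale c (compliance P s) x"
    by (simp add: compliance_def fscale_def algebra_simps)
qed

lemma compliance_bounded:
  assumes t: "t \<in> bounded_fields (Dom P)"
  shows "compliance P t \<in> bounded_fields (Dom P)"
proof -
  obtain c C where c: "0 < c" "\<And>x. x \<in> Dom P \<Longrightarrow> c \<le> lame_mu P x"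
    "\<And>x. x \<in> Dom P \<Longrightarrow> c \<le> lame_lambda P x + lame_mu P x" "\<And>x. x \<in> Dom P \<Longrightarrow> \<bar>lame_lambda P x\<bar> \<le> C"
    by (rule coefficients) blast
  define r where "r x = 1 / (2 * lame_mu P x)" for x
  define q where "q x = lame_lambda P x / (2 * lame_lambda P x + 2 * lame_mu P x)" for x
  have r: "r \<in> bounded_fields (Dom P)"
  proof (rule bounded_fieldsI)
    show "r \<in> borel_measurable (lebesgue_on (Dom P))"
      unfolding r_def using coefficients_measurable by measurable
    show "norm (r x) \<le> 1 / (2 * c)" if "x \<in> Dom P" for x
      using c(1) c(2)[OF that] by (auto simp: r_def intro!: frac_le)
  qed
  have q: "q \<in> bounded_fields (Dom P)"
  proof (rule bounded_fieldsI)
    show "q \<in> borel_measurable (lebesgue_on (Dom P))"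
      unfolding q_def using coefficients_measurable by measurable
    show "norm (q x) \<le> C / (2 * c)" if "x \<in> Dom P" for x
      using c(1) c(3)[OF that] c(4)[OF that] by (auto simp: q_def abs_divide intro!: frac_le)
  qed
  have "linear (\<lambda>A :: mat2. - (trace A *\<^sub>R mat 1) :: mat2)"
    by (rule linearI) (simp_all add: trace_def sum.distrib algebra_simps sum_distrib_left)
  then have "bounded_linear (\<lambda>A :: mat2. - (trace A *\<^sub>R mat 1) :: mat2)"
    by (rule linear_conv_bounded_linear[THEN iffD1])
  then have "(\<lambda>x. r x *\<^sub>R (t x + q x *\<^sub>R - (trace (t x) *\<^sub>R mat 1))) \<in> bounded_fields (Dom P)"
    by (intro bounded_fields_times bounded_fields_add r q t) (rule bounded_fields_linear[OF _ t])
  moreover have "(\<lambda>x. r x *\<^sub>R (t x + q x *\<^sub>R - (trace (t x) *\<^sub>R mat 1))) = compliance P t"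
    by (simp add: fun_eq_iff compliance_def r_def q_def)
  ultimately show ?thesis by simp
qed

lemma semi_inner_compliance: "semi_inner fscale stresses compliance_ip"
proof -
  interpret L: semi_inner fscale "bounded_fields (Dom P) :: (pt \<Rightarrow> mat2) set" "ip (Dom P)"
    by (rule L2)
  have w: "s \<in> bounded_fields (Dom P)" "compliance P s \<in> bounded_fields (Dom P)" if "s \<in> stresses" for s
    using that stresses_bounded compliance_bounded by blast+
  note eq = ip_eq_integral[OF fmeasurableD[OF domain(4)]]
  show ?thesis
  proof (rule semi_inner_fieldsI)
    show "compliance_ip s t = compliance_ip t s" for s t
      unfolding compliance_ip_def eq compliance_inner by (simp add: inner_commute ac_simps)
    show "0 \<le> compliance_ip s s" for s
      unfolding compliance_ip_def eq
    proof (rule Bochner_Integration.integral_nonneg)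
      fix x assume "x \<in> space (lebesgue_on (Dom P))"
      then show "0 \<le> compliance P s x \<bullet> s x"
        using compliance_pos[of x s] by (cases "s x = 0") auto
    qed
    show "functional_on fscale stresses (\<lambda>s. compliance_ip s t)" if t: "t \<in> stresses" for t
    proof (rule functional_onI)
      fix s s' assume s: "s \<in> stresses" and s': "s' \<in> stresses"
      show "compliance_ip (s + s') t = compliance_ip s t + compliance_ip s' t"
        unfolding compliance_ip_def compliance_add by (rule L.add_left[OF w(2)[OF s] w(2)[OF s'] w(1)[OF t]])
    next
      fix c s assume s: "s \<in> stresses"
      show "compliance_ip (fscale c s) t = c * compliance_ip s t"
        unfolding compliance_ip_def compliance_scale by (rule L.scale_left[OF w(2)[OF s] w(1)[OF t]])
    qed
  qed (rule subspace_stresses)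
qed

lemma compliance_definite:
  assumes s: "s \<in> stresses" and 0: "compliance_ip s s = 0"
  shows "s = 0"
proof (rule stress_eq_0[OF s])
  have sb: "s \<in> bounded_fields (Dom P)" using s stresses_bounded by blast
  have "negligible {x \<in> Dom P. compliance P s x \<bullet> s x \<noteq> 0}"
  proof (rule negligible_integral_zero[OF _ integrable_inner[OF domain(4) compliance_bounded[OF sb] sb]])
    show "0 \<le> compliance P s x \<bullet> s x" if "x \<in> Dom P" for x
      using compliance_pos[OF that, of s] by (cases "s x = 0") auto
    show "(\<integral>x. compliance P s x \<bullet> s x \<partial>lebesgue_on (Dom P)) = 0"
      using 0 by (simp add: compliance_ip_def ip_eq_integral fmeasurableD domain(4))
  qed (simp add: fmeasurableD domain(4))
  moreover have "{x \<in> Dom P. s x \<noteq> 0} \<subseteq> {x \<in> Dom P. compliance P s x \<bullet> s x \<noteq> 0}"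
    using compliance_pos[of _ s] by force
  ultimately show "negligible {x \<in> Dom P. s x \<noteq> 0}" by (rule negligible_subset)
qed

end

section \<open>The energy form\<close>

context fine_mesh
begin

interpretation S: semi_inner fscale stresses "ip (Dom P)" by (rule semi_inner_stress)
interpretation C: semi_inner fscale stresses compliance_ip by (rule semi_inner_compliance)

lemma A_op:
  assumes "s \<in> stresses"
  shows "A_op P (Dom P) s \<in> stresses"
    and "w \<in> stresses \<Longrightarrow> ip (Dom P) (A_op P (Dom P) s) w = compliance_ip s w"
  unfolding A_op_def compliance_ip_def
  using representer[OF C.functional_right[OF assms, unfolded compliance_ip_def]] by blast+

text \<open>Surjectivity is the Riesz representation of \<open>w \<mapsto> (p, w)\<close> with respect to the compliance
  product, injectivity its definiteness.\<close>

lemma A_op_bij: "bij_betw (A_op P (Dom P)) stresses stresses"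
proof (rule bij_betwI')
  show "A_op P (Dom P) s = A_op P (Dom P) t \<longleftrightarrow> s = t" if s: "s \<in> stresses" and t: "t \<in> stresses" for s t
  proof
    assume eq: "A_op P (Dom P) s = A_op P (Dom P) t"
    have d: "s - t \<in> stresses" using S.diff_mem[OF s t] .
    have "compliance_ip s w = compliance_ip t w" if "w \<in> stresses" for w
      using A_op(2)[OF s that] A_op(2)[OF t that] eq by simp
    then have "compliance_ip (s - t) (s - t) = 0" using C.diff_left[OF s t d] d by simp
    then show "s = t" using compliance_definite[OF d] by simp
  qed simp
  show "A_op P (Dom P) s \<in> stresses" if "s \<in> stresses" for s
    by (rule A_op(1)[OF that])
  show "\<exists>s\<in>stresses. p = A_op P (Dom P) s" if p: "p \<in> stresses" for p
  proof -
    obtain s where s: "s \<in> stresses" "\<forall>w\<in>stresses. compliance_ip s w = ip (Dom P) p w"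
      using stress_riesz[OF subspace_stresses order_refl semi_inner_compliance compliance_definite
          S.functional_right[OF p]] by blast
    have "p = A_op P (Dom P) s"
      by (rule stress_unique[OF p A_op(1)[OF s(1)]]) (use s A_op(2)[OF s(1)] in simp)
    then show ?thesis using s(1) by blast
  qed
qed

lemma Gamma_on_bounded: "Gamma_on P (Dom P) \<subseteq> bounded_fields (Dom P)"
proof
  fix g assume "g \<in> Gamma_on P (Dom P)"
  then obtain h where h: "h \<in> Gamma_h P" "g = restr (Dom P) h" by (auto simp: Gamma_on_def)
  have "finite (corners M)" for M by (cases M) simp
  then have "finite (interaction_regions P)"
    by (simp add: interaction_regions_def finite_macros)
  moreover have "open A" if "A \<in> interaction_regions P" for A
    using that open_cell by (auto simp: interaction_regions_def)
  ultimately have hb: "h \<in> bounded_fields (Dom P)"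
    using piecewise_const_bounded h(1) unfolding Gamma_h_def by blast
  then obtain B where B: "h \<in> borel_measurable (lebesgue_on (Dom P))" "\<And>x. x \<in> Dom P \<Longrightarrow> norm (h x) \<le> B"
    by (rule bounded_fieldsE) blast
  show "g \<in> bounded_fields (Dom P)"
  proof (rule bounded_fieldsI)
    show "g \<in> borel_measurable (lebesgue_on (Dom P))"
      using B(1) by (subst measurable_cong[where g = h]) (simp_all add: h(2) restr_def)
    show "norm (g x) \<le> B" if "x \<in> Dom P" for x
      using B(2)[OF that] that by (simp add: h(2) restr_def)
  qed
qed

lemma subspace_Gamma_on: "fields.subspace (Gamma_on P K)"
proof -
  have H: "fields.subspace (Gamma_h P)" unfolding Gamma_h_def by (rule subspace_piecewise_const)
  have 0: "0 = restr K (0 :: pt \<Rightarrow> real)" by (simp add: restr_def fun_eq_iff)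
  have add: "restr K f + restr K g = restr K (f + g)" for f g :: "pt \<Rightarrow> real"
    by (simp add: restr_def fun_eq_iff)
  have scale: "fscale c (restr K f) = restr K (fscale c f)" for c and f :: "pt \<Rightarrow> real"
    by (simp add: restr_def fscale_def fun_eq_iff)
  show ?thesis
    unfolding fields.subspace_def Gamma_on_def
  proof (intro conjI ballI allI)
    show "0 \<in> restr K ` Gamma_h P" using 0 fields.subspace_0[OF H] by (rule image_eqI)
    show "f + g \<in> restr K ` Gamma_h P" if "f \<in> restr K ` Gamma_h P" "g \<in> restr K ` Gamma_h P" for f g
      using that by (auto simp only: add intro!: imageI fields.subspace_add[OF H])
    show "fscale c f \<in> restr K ` Gamma_h P" if "f \<in> restr K ` Gamma_h P" for c f
      using that by (auto simp only: scale intro!: imageI fields.subspace_scale[OF H])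
  qed
qed

lemma asym_bounded:
  assumes "w \<in> stresses"
  shows "(\<lambda>x. asym (w x)) \<in> bounded_fields (Dom P)"
proof -
  have "linear asym" by (rule linearI) (simp_all add: asym_def algebra_simps)
  then have "bounded_linear asym" by (rule linear_conv_bounded_linear[THEN iffD1])
  then show ?thesis using bounded_fields_linear assms stresses_bounded by blast
qed

lemma asym_functional:
  assumes g: "g \<in> bounded_fields (Dom P)"
  shows "functional_on fscale stresses (\<lambda>w. ip (Dom P) (\<lambda>x. asym (w x)) g)"
proof -
  interpret L: semi_inner fscale "bounded_fields (Dom P) :: (pt \<Rightarrow> real) set" "ip (Dom P)"
    by (rule L2)
  note b = asym_bounded
  show ?thesis
  proof (rule functional_onI)
    fix w w' assume w: "w \<in> stresses" and w': "w' \<in> stresses"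
    have "(\<lambda>x. asym ((w + w') x)) = (\<lambda>x. asym (w x)) + (\<lambda>x. asym (w' x))"
      by (simp add: fun_eq_iff asym_def)
    then show "ip (Dom P) (\<lambda>x. asym ((w + w') x)) g
        = ip (Dom P) (\<lambda>x. asym (w x)) g + ip (Dom P) (\<lambda>x. asym (w' x)) g"
      using L.add_left[OF b[OF w] b[OF w'] g] by metis
  next
    fix c w assume w: "w \<in> stresses"
    have "(\<lambda>x. asym (fscale c w x)) = fscale c (\<lambda>x. asym (w x))"
      by (simp add: fun_eq_iff asym_def fscale_def algebra_simps)
    then show "ip (Dom P) (\<lambda>x. asym (fscale c w x)) g = c * ip (Dom P) (\<lambda>x. asym (w x)) g"
      using L.scale_left[OF b[OF w] g] by metis
  qed
qed

lemma as_star: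
  assumes "g \<in> Gamma_on P (Dom P)"
  shows "as_star P (Dom P) g \<in> stresses"
    and "w \<in> stresses \<Longrightarrow> ip (Dom P) (as_star P (Dom P) g) w = ip (Dom P) (\<lambda>x. asym (w x)) g"
  unfolding as_star_def
  using representer[OF asym_functional] assms Gamma_on_bounded by blast+

text \<open>The image of the discrete multipliers under the adjoint of the asymmetry operator.\<close>

definition skew_stresses :: "(pt \<Rightarrow> mat2) set" where
  "skew_stresses = as_star P (Dom P) ` Gamma_on P (Dom P)"

lemma skew_subset: "skew_stresses \<subseteq> stresses"
  using as_star(1) by (auto simp: skew_stresses_def)

lemma subspace_skew: "fields.subspace skew_stresses"
proof -
  interpret L: semi_inner fscale "bounded_fields (Dom P) :: (pt \<Rightarrow> real) set" "ip (Dom P)"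
    by (rule L2)
  note G = subspace_Gamma_on[of "Dom P"]
  have b: "g \<in> bounded_fields (Dom P)" if "g \<in> Gamma_on P (Dom P)" for g
    using that Gamma_on_bounded by blast
  note as = asym_bounded
  have add: "as_star P (Dom P) f + as_star P (Dom P) g = as_star P (Dom P) (f + g)"
    if f: "f \<in> Gamma_on P (Dom P)" and g: "g \<in> Gamma_on P (Dom P)" for f g
  proof (rule stress_unique)
    have fg: "f + g \<in> Gamma_on P (Dom P)" by (rule fields.subspace_add[OF G f g])
    show "as_star P (Dom P) f + as_star P (Dom P) g \<in> stresses"
      by (intro S.add_mem as_star f g)
    show "as_star P (Dom P) (f + g) \<in> stresses" by (rule as_star(1)[OF fg])
    show "ip (Dom P) (as_star P (Dom P) f + as_star P (Dom P) g) w
        = ip (Dom P) (as_star P (Dom P) (f + g)) w" if w: "w \<in> stresses" for w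
      unfolding S.add_left[OF as_star(1)[OF f] as_star(1)[OF g] w]
        as_star(2)[OF f w] as_star(2)[OF g w] as_star(2)[OF fg w]
      by (rule L.add_right[symmetric]) (intro as w b f g)+
  qed
  have scale: "fscale c (as_star P (Dom P) g) = as_star P (Dom P) (fscale c g)"
    if g: "g \<in> Gamma_on P (Dom P)" for c g
  proof (rule stress_unique)
    have cg: "fscale c g \<in> Gamma_on P (Dom P)" by (rule fields.subspace_scale[OF G g])
    show "fscale c (as_star P (Dom P) g) \<in> stresses" by (intro S.scale_mem as_star g)
    show "as_star P (Dom P) (fscale c g) \<in> stresses" by (rule as_star(1)[OF cg])
    show "ip (Dom P) (fscale c (as_star P (Dom P) g)) w
        = ip (Dom P) (as_star P (Dom P) (fscale c g)) w" if w: "w \<in> stresses" for w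
      unfolding S.scale_left[OF as_star(1)[OF g] w] as_star(2)[OF g w] as_star(2)[OF cg w]
      by (rule L.scale_right[symmetric]) (intro as w b g)+
  qed
  have "as_star P (Dom P) 0 = fscale 0 (as_star P (Dom P) 0)"
    using scale[OF fields.subspace_0[OF G], of 0] by simp
  then have 0: "0 = as_star P (Dom P) 0" by simp
  show ?thesis
    unfolding fields.subspace_def skew_stresses_def
  proof (intro conjI ballI allI)
    show "0 \<in> as_star P (Dom P) ` Gamma_on P (Dom P)"
      using 0 fields.subspace_0[OF G] by (rule image_eqI)
    show "s + t \<in> as_star P (Dom P) ` Gamma_on P (Dom P)"
      if "s \<in> as_star P (Dom P) ` Gamma_on P (Dom P)" "t \<in> as_star P (Dom P) ` Gamma_on P (Dom P)" for s t
      using that by (auto simp only: add intro!: imageI fields.subspace_add[OF G])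
    show "fscale c s \<in> as_star P (Dom P) ` Gamma_on P (Dom P)"
      if "s \<in> as_star P (Dom P) ` Gamma_on P (Dom P)" for c s
      using that by (auto simp only: scale intro!: imageI fields.subspace_scale[OF G])
  qed
qed

text \<open>The functional that defines the discrete gradient, with each edge integral evaluated by the
  midpoint rule.  This is exact, because a dual edge runs inside one macro-element, where the
  displacement is constant.\<close>

definition flux :: "(pt \<Rightarrow> pt) \<Rightarrow> (pt \<Rightarrow> mat2) \<Rightarrow> real" where
  "flux v w = (\<Sum>e\<in>{e \<in> F_dl P. seg e \<subseteq> closure (Dom P)}.
     dist (fst e) (snd e) * (v (midpoint (fst e) (snd e)) \<bullet> normal_jump P w e))"

lemma edge_ip_dual:
  assumes v: "v \<in> U_h P" and e: "e \<in> F_dl P"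
  shows "edge_ip e v (\<lambda>_. q) = dist (fst e) (snd e) * (v (midpoint (fst e) (snd e)) \<bullet> q)"
proof (cases "fst e = snd e")
  case True
  then show ?thesis by (simp add: edge_ip_def)
next
  case False
  obtain M where M: "M \<in> macros P" "e \<in> dual_edges M (centre P M)"
    using e by (auto simp: F_dl_def)
  have sub: "open_segment (fst e) (snd e) \<subseteq> cell M" using centre(2)[OF M(1)] M(2) by (cases e) auto
  obtain c where c: "\<forall>x\<in>cell M. v x = c"
    using v M(1) unfolding U_h_def piecewise_const_def by blast
  have "linepath (fst e) (snd e) t \<in> open_segment (fst e) (snd e)" if "0 < t" "t < 1" for t
    using that False by (auto simp: in_segment linepath_def)
  then have const: "v (linepath (fst e) (snd e) t) = c" if "0 < t" "t < 1" for t
    using that sub c by blast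
  have "midpoint (fst e) (snd e) = linepath (fst e) (snd e) (1 / 2)"
    by (simp add: midpoint_def linepath_def scaleR_add_right)
  then have mid: "v (midpoint (fst e) (snd e)) = c" using const[of "1 / 2"] by simp
  have "integral {0..1} (\<lambda>t. v (linepath (fst e) (snd e) t) \<bullet> q) = integral {0..1::real} (\<lambda>t. c \<bullet> q)"
  proof (rule integral_spike)
    show "negligible {0, 1 :: real}" by simp
    show "c \<bullet> q = v (linepath (fst e) (snd e) t) \<bullet> q" if "t \<in> {0..1} - {0, 1}" for t
      using const[of t] that by auto
  qed
  then show ?thesis by (simp add: edge_ip_def mid)
qed

lemma flux_functional: "functional_on fscale W (flux v)"
  by (rule functional_onI)
    (simp_all add: flux_def normal_jump_add normal_jump_scale inner_add_right distrib_left
      sum.distrib sum_distrib_left algebra_simps)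

lemma flux_add: "flux (v + v') w = flux v w + flux v' w"
  by (simp add: flux_def inner_add_left distrib_left sum.distrib)

lemma flux_scale: "flux (fscale c v) w = c * flux v w"
  by (simp add: flux_def fscale_def sum_distrib_left algebra_simps)

lemma J_op:
  assumes "v \<in> U_h P"
  shows "J_op P (Dom P) v \<in> stresses"
    and "w \<in> stresses \<Longrightarrow> ip (Dom P) (J_op P (Dom P) v) w = flux v w"
proof -
  have "(\<lambda>w. \<Sum>e\<in>{e \<in> F_dl P. seg e \<subseteq> closure (Dom P)}. edge_ip e v (\<lambda>_. normal_jump P w e)) = flux v"
    unfolding flux_def by (intro ext sum.cong refl edge_ip_dual[OF assms]) simp
  then have "J_op P (Dom P) v = representer P (Dom P) (flux v)" by (simp add: J_op_def)
  then show "J_op P (Dom P) v \<in> stresses"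
    and "w \<in> stresses \<Longrightarrow> ip (Dom P) (J_op P (Dom P) v) w = flux v w"
    using representer[OF flux_functional] by simp_all
qed

definition stress_of :: "(pt \<Rightarrow> pt) \<Rightarrow> pt \<Rightarrow> mat2" where
  "stress_of v = inv_into stresses (A_op P (Dom P)) (P_star P (Dom P) v)"

text \<open>The stress of a displacement solves the weakly symmetric mixed problem: it is orthogonal to
  the skew stresses, and up to a skew stress it represents the flux.  The multiplier is hidden in
  the existential quantifier, so that only a uniquely determined quantity is talked about.\<close>

definition is_stress_of :: "(pt \<Rightarrow> pt) \<Rightarrow> (pt \<Rightarrow> mat2) \<Rightarrow> bool" where
  "is_stress_of v t \<longleftrightarrow> t \<in> stresses \<and> (\<forall>s\<in>skew_stresses. compliance_ip t s = 0) \<and>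
     (\<exists>s\<in>skew_stresses. \<forall>w\<in>stresses. compliance_ip t w + compliance_ip s w = flux v w)"

text \<open>The difference of two solutions has the same compliance products as a skew stress, and it is
  orthogonal to all skew stresses.  So it is orthogonal to itself.\<close>

lemma is_stress_of_unique:
  assumes t: "is_stress_of v t" and t': "is_stress_of v t'"
  shows "t = t'"
proof -
  interpret G: semi_inner fscale skew_stresses compliance_ip
    by (rule C.restrict[OF subspace_skew skew_subset])
  obtain s where s: "s \<in> skew_stresses" "\<forall>w\<in>stresses. compliance_ip t w + compliance_ip s w = flux v w"
    using t by (auto simp: is_stress_of_def)
  obtain s' where s': "s' \<in> skew_stresses" "\<forall>w\<in>stresses. compliance_ip t' w + compliance_ip s' w = flux v w"
    using t' by (auto simp: is_stress_of_def)
  have tS: "t \<in> stresses" "t' \<in> stresses" "s \<in> stresses" "s' \<in> stresses"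
    using t t' s(1) s'(1) skew_subset by (auto simp: is_stress_of_def)
  define d where "d = t - t'"
  have d: "d \<in> stresses" unfolding d_def by (intro S.diff_mem tS)
  have "compliance_ip (s' - s) d = compliance_ip s' d - compliance_ip s d"
    by (rule C.diff_left[OF tS(4) tS(3) d])
  also have "\<dots> = compliance_ip t d - compliance_ip t' d"
    using s(2) s'(2) d by (smt (verit))
  also have "\<dots> = compliance_ip d d"
    unfolding d_def by (rule C.diff_left[symmetric, OF tS(1,2) d[unfolded d_def]])
  finally have eq: "compliance_ip (s' - s) d = compliance_ip d d" .
  have g: "s' - s \<in> skew_stresses" by (rule G.diff_mem[OF s'(1) s(1)])
  then have gS: "s' - s \<in> stresses" using skew_subset by blast
  have "compliance_ip d (s' - s) = compliance_ip t (s' - s) - compliance_ip t' (s' - s)"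
    unfolding d_def by (rule C.diff_left[OF tS(1,2) gS])
  also have "\<dots> = 0" using t t' g by (simp add: is_stress_of_def)
  finally have "compliance_ip d d = 0" using eq C.sym[OF d gS] by simp
  then have "d = 0" by (rule compliance_definite[OF d])
  then show ?thesis by (simp add: d_def)
qed

text \<open>The multiplier exists although the adjoint of the asymmetry operator need not be injective:
  projecting the discrete gradient onto the skew stresses gives a skew stress, and any
  preimage of it is a valid choice.\<close>

lemma stress_of:
  assumes v: "v \<in> U_h P"
  shows "is_stress_of v (stress_of v)" and "A_op P (Dom P) (stress_of v) = P_star P (Dom P) v"
proof -
  let ?J = "J_op P (Dom P) v" and ?G = "Gamma_on P (Dom P)"
    and ?as = "as_star P (Dom P)" and ?A = "A_op P (Dom P)"
  have G: "semi_inner fscale skew_stresses compliance_ip"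
    by (rule C.restrict[OF subspace_skew skew_subset])
  have L: "functional_on fscale skew_stresses (ip (Dom P) ?J)"
    by (rule functional_on_subset[OF S.functional_right[OF J_op(1)[OF v]] skew_subset])
  have "\<exists>s\<in>skew_stresses. \<forall>w\<in>skew_stresses. compliance_ip s w = ip (Dom P) ?J w"
    by (rule stress_riesz[OF subspace_skew skew_subset G _ L])
      (use compliance_definite skew_subset in blast)
  then obtain g0 where g0: "g0 \<in> ?G" "\<forall>w\<in>skew_stresses. compliance_ip (?as g0) w = ip (Dom P) ?J w"
    by (auto simp: skew_stresses_def)
  have residual: "ip (Dom P) (?J - ?A (?as g)) w = ip (Dom P) ?J w - compliance_ip (?as g) w"
    if "g \<in> ?G" "w \<in> stresses" for g w
    using S.diff_left[OF J_op(1)[OF v] A_op(1)[OF as_star(1)[OF that(1)]] that(2)]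
      A_op(2)[OF as_star(1)[OF that(1)] that(2)] by simp
  define g where "g = gamma_op P (Dom P) v"
  have "g0 \<in> ?G \<and> (\<forall>\<xi>\<in>?G. ip (Dom P) (?J - ?A (?as g0)) (?as \<xi>) = 0)"
    using g0 residual as_star(1) by (auto simp: skew_stresses_def)
  from someI[of "\<lambda>g. g \<in> ?G \<and> (\<forall>\<xi>\<in>?G. ip (Dom P) (?J - ?A (?as g)) (?as \<xi>) = 0)", OF this]
  have g: "g \<in> ?G" "\<forall>\<xi>\<in>?G. ip (Dom P) (?J - ?A (?as g)) (?as \<xi>) = 0"
    unfolding g_def gamma_op_def by blast+
  have P_eq: "P_star P (Dom P) v = ?J - ?A (?as g)" by (simp add: P_star_def g_def)
  have PS: "P_star P (Dom P) v \<in> stresses"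
    unfolding P_eq by (intro S.diff_mem J_op[OF v] A_op as_star g)
  have im: "P_star P (Dom P) v \<in> ?A ` stresses" using PS A_op_bij by (simp add: bij_betw_def)
  show A: "?A (stress_of v) = P_star P (Dom P) v"
    unfolding stress_of_def by (rule f_inv_into_f[OF im])
  have t: "stress_of v \<in> stresses" unfolding stress_of_def by (rule inv_into_into[OF im])
  have ct: "compliance_ip (stress_of v) w = ip (Dom P) ?J w - compliance_ip (?as g) w"
    if "w \<in> stresses" for w
    using A_op(2)[OF t that] residual[OF g(1) that] A P_eq by simp
  show "is_stress_of v (stress_of v)"
    unfolding is_stress_of_def
  proof (intro conjI ballI)
    show "compliance_ip (stress_of v) s = 0" if s: "s \<in> skew_stresses" for s
    proof -
      have "ip (Dom P) (?J - ?A (?as g)) s = 0" using g(2) s by (auto simp: skew_stresses_def)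
      moreover have "s \<in> stresses" using s skew_subset by blast
      ultimately show ?thesis using ct residual[OF g(1)] by simp
    qed
    show "\<exists>s\<in>skew_stresses. \<forall>w\<in>stresses. compliance_ip (stress_of v) w + compliance_ip s w = flux v w"
      by (rule bexI[of _ "?as g"]) (use ct J_op(2)[OF v] g(1) in \<open>auto simp: skew_stresses_def\<close>)
  qed (rule t)
qed

lemma stress_mem: "v \<in> U_h P \<Longrightarrow> stress_of v \<in> stresses"
  using stress_of(1) by (simp add: is_stress_of_def)

lemma stress_of_add:
  assumes v: "v \<in> U_h P" and v': "v' \<in> U_h P"
  shows "stress_of (v + v') = stress_of v + stress_of v'"
proof (rule is_stress_of_unique)
  let ?t = "stress_of v" and ?t' = "stress_of v'"
  show "is_stress_of (v + v') (stress_of (v + v'))"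
    by (intro stress_of fields.subspace_add[OF subspace_U_h] v v')
  obtain s where s: "s \<in> skew_stresses" "\<forall>w\<in>stresses. compliance_ip ?t w + compliance_ip s w = flux v w"
    using stress_of(1)[OF v] by (auto simp: is_stress_of_def)
  obtain s' where s': "s' \<in> skew_stresses" "\<forall>w\<in>stresses. compliance_ip ?t' w + compliance_ip s' w = flux v' w"
    using stress_of(1)[OF v'] by (auto simp: is_stress_of_def)
  have sS: "s \<in> stresses" "s' \<in> stresses" using s s' skew_subset by auto
  note t = stress_mem[OF v] stress_mem[OF v']
  have orth: "compliance_ip ?t w = 0" "compliance_ip ?t' w = 0" if "w \<in> skew_stresses" for w
    using that stress_of(1)[OF v] stress_of(1)[OF v'] by (auto simp: is_stress_of_def)
  show "is_stress_of (v + v') (?t + ?t')"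
    unfolding is_stress_of_def
  proof (intro conjI ballI)
    show "?t + ?t' \<in> stresses" by (rule S.add_mem[OF t])
    show "compliance_ip (?t + ?t') w = 0" if w: "w \<in> skew_stresses" for w
    proof -
      have "w \<in> stresses" using w skew_subset by blast
      then show ?thesis using C.add_left[OF t] orth[OF w] by simp
    qed
    show "\<exists>s\<in>skew_stresses. \<forall>w\<in>stresses. compliance_ip (?t + ?t') w + compliance_ip s w = flux (v + v') w"
    proof (intro bexI ballI)
      show "s + s' \<in> skew_stresses" by (rule fields.subspace_add[OF subspace_skew s(1) s'(1)])
      show "compliance_ip (?t + ?t') w + compliance_ip (s + s') w = flux (v + v') w"
        if w: "w \<in> stresses" for w
        unfolding C.add_left[OF t w] C.add_left[OF sS w] flux_add
        using s(2) s'(2) w by (smt (verit))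
    qed
  qed
qed

lemma stress_of_scale:
  assumes v: "v \<in> U_h P"
  shows "stress_of (fscale c v) = fscale c (stress_of v)"
proof (rule is_stress_of_unique)
  let ?t = "stress_of v"
  show "is_stress_of (fscale c v) (stress_of (fscale c v))"
    by (intro stress_of fields.subspace_scale[OF subspace_U_h] v)
  obtain s where s: "s \<in> skew_stresses" "\<forall>w\<in>stresses. compliance_ip ?t w + compliance_ip s w = flux v w"
    using stress_of(1)[OF v] by (auto simp: is_stress_of_def)
  have sS: "s \<in> stresses" using s skew_subset by auto
  note t = stress_mem[OF v]
  have orth: "compliance_ip ?t w = 0" if "w \<in> skew_stresses" for w
    using that stress_of(1)[OF v] by (auto simp: is_stress_of_def)
  show "is_stress_of (fscale c v) (fscale c ?t)"
    unfolding is_stress_of_def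
  proof (intro conjI ballI)
    show "fscale c ?t \<in> stresses" by (rule S.scale_mem[OF t])
    show "compliance_ip (fscale c ?t) w = 0" if w: "w \<in> skew_stresses" for w
    proof -
      have "w \<in> stresses" using w skew_subset by blast
      then show ?thesis using C.scale_left[OF t] orth[OF w] by simp
    qed
    show "\<exists>s\<in>skew_stresses. \<forall>w\<in>stresses. compliance_ip (fscale c ?t) w + compliance_ip s w = flux (fscale c v) w"
    proof (intro bexI ballI)
      show "fscale c s \<in> skew_stresses" by (rule fields.subspace_scale[OF subspace_skew s(1)])
      show "compliance_ip (fscale c ?t) w + compliance_ip (fscale c s) w = flux (fscale c v) w"
        if w: "w \<in> stresses" for w
        unfolding C.scale_left[OF t w] C.scale_left[OF sS w] flux_scale
        using s(2) w by (simp add: distrib_left[symmetric])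
    qed
  qed
qed

text \<open>With \<open>A\<close> the discrete compliance and \<open>t\<close>, \<open>s\<close> the stresses of \<open>v\<close>, \<open>w\<close>, the energy form is
  \<open>(t, A s)\<close>.  Symmetry and nonnegativity are inherited from the compliance, bilinearity from
  the linearity of the stress in the displacement.\<close>

lemma a_form_eq:
  assumes v: "v \<in> U_h P" and w: "w \<in> U_h P"
  shows "a_form P v w = compliance_ip (stress_of w) (stress_of v)"
proof -
  have Aw: "A_op P (Dom P) (stress_of w) \<in> stresses" by (rule A_op(1)[OF stress_mem[OF w]])
  have "a_form P v w = ip (Dom P) (stress_of v) (A_op P (Dom P) (stress_of w))"
    unfolding stress_of(2)[OF w] by (simp add: a_form_def energy_on_def stress_of_def stresses_def)
  also have "\<dots> = ip (Dom P) (A_op P (Dom P) (stress_of w)) (stress_of v)"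
    by (rule S.sym[OF stress_mem[OF v] Aw])
  also have "\<dots> = compliance_ip (stress_of w) (stress_of v)"
    by (rule A_op(2)[OF stress_mem[OF w] stress_mem[OF v]])
  finally show ?thesis .
qed

lemma semi_inner_a_form: "semi_inner fscale (U_h P) (a_form P)"
proof (rule semi_inner_fieldsI)
  show "fields.subspace (U_h P)" by (rule subspace_U_h)
  show "a_form P v w = a_form P w v" if "v \<in> U_h P" "w \<in> U_h P" for v w
    using that by (simp add: a_form_eq C.sym stress_mem)
  show "0 \<le> a_form P v v" if "v \<in> U_h P" for v
    using that by (simp add: a_form_eq C.nonneg stress_mem)
  show "functional_on fscale (U_h P) (\<lambda>v. a_form P v w)" if w: "w \<in> U_h P" for w
  proof (rule functional_onI)
    fix v v' assume v: "v \<in> U_h P" and v': "v' \<in> U_h P"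
    have vv: "v + v' \<in> U_h P" by (rule fields.subspace_add[OF subspace_U_h v v'])
    show "a_form P (v + v') w = a_form P v w + a_form P v' w"
      unfolding a_form_eq[OF vv w] a_form_eq[OF v w] a_form_eq[OF v' w] stress_of_add[OF v v']
      by (rule C.add_right[OF stress_mem[OF w] stress_mem[OF v] stress_mem[OF v']])
  next
    fix c v assume v: "v \<in> U_h P"
    have cv: "fscale c v \<in> U_h P" by (rule fields.subspace_scale[OF subspace_U_h v])
    show "a_form P (fscale c v) w = c * a_form P v w"
      unfolding a_form_eq[OF cv w] a_form_eq[OF v w] stress_of_scale[OF v]
      by (rule C.scale_right[OF stress_mem[OF w] stress_mem[OF v]])
  qed
qed

end

section \<open>The multiscale space\<close>

locale multiscale =
  fixes P :: "'z ms_problem_scheme" and \<kappa> :: real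
  assumes multiscale: "multiscale_setup \<kappa> P"

sublocale multiscale \<subseteq> fine_mesh P
  using multiscale by unfold_locales (simp add: multiscale_setup_def)

context multiscale
begin

lemma coarse: "coarse_partition \<kappa> P"
  using multiscale by (simp add: multiscale_setup_def)

lemma coarse_quads: "quad_partition (Dom P) (coarse P ` {1..n_coarse P})"
  using coarse by (simp add: coarse_partition_def)

lemma mesh_size_pos: "0 < mesh_size_H P"
proof -
  have "{1..n_coarse P} \<noteq> {}"
  proof
    assume e: "{1..n_coarse P} = {}"
    have "closure (Dom P) = (\<Union>Q\<in>coarse P ` {1..n_coarse P}. region Q)"
      using coarse_quads unfolding quad_partition_def by blast
    then show False unfolding e using domain(3) by simp
  qed
  then obtain i where i: "i \<in> {1..n_coarse P}" by blast
  then have "is_quadrilateral (coarse P i)" using coarse_quads unfolding quad_partition_def by blast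
  then have "0 < diameter (region (coarse P i))" by (rule diameter_region_pos)
  also have "\<dots> \<le> mesh_size_H P" unfolding mesh_size_H_def using i by (intro Max_ge) auto
  finally show ?thesis .
qed

lemma coarse_region_macros:
  assumes "i \<in> {1..n_coarse P}"
  obtains S where "S \<subseteq> macros P" "region (coarse P i) = (\<Union>M\<in>S. region M)"
proof -
  have "\<exists>S\<subseteq>macros P. region (coarse P i) = (\<Union>M\<in>S. region M)"
    using coarse assms unfolding coarse_partition_def by blast
  then show thesis using that by blast
qed

text \<open>Oversampling regions are resolved by the macro-elements, which is why the localized basis
  functions, although cut off at the boundary of such a region, are still discrete
  displacements.\<close>

lemma enlarged_macros:
  assumes i: "i \<in> {1..n_coarse P}"
  shows "\<exists>S\<subseteq>macros P. enlarged P i m = (\<Union>M\<in>S. region M)"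
proof (cases m)
  case 0
  obtain S where S: "S \<subseteq> macros P" "region (coarse P i) = (\<Union>M\<in>S. region M)"
    by (rule coarse_region_macros[OF i])
  have "enlarged P i m = (\<Union>M\<in>S. region M)" unfolding 0 enlarged.simps(1) by (rule S(2))
  then show ?thesis using S(1) by blast
next
  case (Suc m')
  have "\<forall>j\<in>{1..n_coarse P}. \<exists>S. S \<subseteq> macros P \<and> region (coarse P j) = (\<Union>M\<in>S. region M)"
  proof
    fix j assume "j \<in> {1..n_coarse P}"
    then show "\<exists>S. S \<subseteq> macros P \<and> region (coarse P j) = (\<Union>M\<in>S. region M)"
      by (rule coarse_region_macros) (rule exI, rule conjI)
  qed
  from bchoice[OF this] obtain S where
    *: "\<forall>j\<in>{1..n_coarse P}. S j \<subseteq> macros P \<and> region (coarse P j) = (\<Union>M\<in>S j. region M)" ..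
  have S: "S j \<subseteq> macros P" "region (coarse P j) = (\<Union>M\<in>S j. region M)"
    if "j \<in> {1..n_coarse P}" for j
    using bspec[OF * that] by (rule conjunct1, rule conjunct2)
  define J where "J = {j \<in> {1..n_coarse P}. region (coarse P j) \<inter> enlarged P i m' \<noteq> {}}"
  have "enlarged P i m = (\<Union>j\<in>J. region (coarse P j))" unfolding Suc enlarged.simps(2) J_def ..
  also have "\<dots> = (\<Union>j\<in>J. \<Union>M\<in>S j. region M)"
    by (rule SUP_cong[OF refl], rule S(2)) (simp add: J_def)
  also have "\<dots> = (\<Union>M\<in>(\<Union>j\<in>J. S j). region M)" by (rule UN_UN_flatten[symmetric])
  finally have "enlarged P i m = (\<Union>M\<in>(\<Union>j\<in>J. S j). region M)" .
  moreover have "(\<Union>j\<in>J. S j) \<subseteq> macros P" by (rule UN_least, rule S(1)) (simp add: J_def)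
  ultimately show ?thesis by blast
qed

definition aux_index :: "(nat \<times> nat) set" where
  "aux_index = (SIGMA i:{1..n_coarse P}. {1..n_aux P i})"

definition phi :: "nat \<times> nat \<Rightarrow> pt \<Rightarrow> pt" where "phi p = eigfun P (fst p) (snd p)"
definition psi :: "nat \<times> nat \<Rightarrow> pt \<Rightarrow> pt" where "psi p = basis_fun P (fst p) (snd p)"

lemma finite_aux_index: "finite aux_index"
  by (simp add: aux_index_def)

lemma eigen:
  assumes i: "i \<in> {1..n_coarse P}" and j: "j \<in> {1..n_aux P i}"
  shows "eigfun P i j \<in> U_on P (region (coarse P i))"
    and "j' \<in> {1..n_aux P i} \<Longrightarrow>
      ip_rho P (Dom P) (eigfun P i j) (eigfun P i j') = (if j = j' then 1 else 0)"
proof -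
  have e: "local_eigenpairs P" using multiscale by (simp add: multiscale_setup_def)
  define d where "d = fields.dim (U_on P (region (coarse P i)))"
  note at_i = bspec[OF e[unfolded local_eigenpairs_def Let_def] i, folded d_def]
  have d: "n_aux P i \<le> d" "\<forall>j\<in>{1..d}. eigfun P i j \<in> U_on P (region (coarse P i))"
    "\<forall>j\<in>{1..d}. \<forall>j'\<in>{1..d}.
       ip_rho P (Dom P) (eigfun P i j) (eigfun P i j') = (if j = j' then 1 else 0)"
    using at_i by blast+
  show "eigfun P i j \<in> U_on P (region (coarse P i))" using d j by simp
  show "ip_rho P (Dom P) (eigfun P i j) (eigfun P i j') = (if j = j' then 1 else 0)"
    if "j' \<in> {1..n_aux P i}" using d j that by simp
qed

lemma U_on_coarse:
  assumes "i \<in> {1..n_coarse P}"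
  shows "U_on P (region (coarse P i)) \<subseteq> U_h P"
  by (rule coarse_region_macros[OF assms]) (simp add: U_on_subset)

lemma phi_mem: "p \<in> aux_index \<Longrightarrow> phi p \<in> U_h P"
proof -
  assume "p \<in> aux_index"
  then have "fst p \<in> {1..n_coarse P}" "snd p \<in> {1..n_aux P (fst p)}" by (auto simp: aux_index_def)
  then show ?thesis using eigen(1) U_on_coarse unfolding phi_def by blast
qed

text \<open>If both fields were nonzero at a point, its macro-element would lie in both coarse
  elements, whose intersection is negligible.\<close>

lemma coarse_supports_disjoint:
  assumes i: "i \<in> {1..n_coarse P}" and i': "i' \<in> {1..n_coarse P}" and ne: "i \<noteq> i'"
    and v: "v \<in> U_on P (region (coarse P i))" and w: "w \<in> U_on P (region (coarse P i'))"
  shows "v x \<bullet> w x = 0"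
proof (rule ccontr)
  assume "v x \<bullet> w x \<noteq> 0"
  then have nz: "v x \<noteq> 0" "w x \<noteq> 0" by auto
  have "v \<in> U_h P" using v U_on_coarse[OF i] by blast
  then have "x \<in> \<Union>(cell ` macros P)" using nz(1) unfolding U_h_def piecewise_const_def by blast
  then obtain M where M: "M \<in> macros P" "x \<in> cell M" by blast
  have x: "x \<in> region (coarse P i)" "x \<in> region (coarse P i')"
    using v w nz by (auto simp: U_on_def restr_def split: if_splits)
  have sub: "cell M \<subseteq> region (coarse P k)" if "k \<in> {1..n_coarse P}" "x \<in> region (coarse P k)" for k
  proof (rule coarse_region_macros[OF that(1)])
    fix S assume "S \<subseteq> macros P" "region (coarse P k) = (\<Union>M\<in>S. region M)"
    then have "cell M \<subseteq> region (coarse P k) \<or> cell M \<inter> region (coarse P k) = {}"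
      using macro_cell_dichotomy[of S M] M(1) by simp
    then show ?thesis using M(2) that(2) by blast
  qed
  have "inj_on (coarse P) {1..n_coarse P}"
    using coarse unfolding coarse_partition_def by (rule conjunct1)
  then have "coarse P i \<noteq> coarse P i'" using inj_on_eq_iff[OF _ i i'] ne by metis
  then have "negligible (region (coarse P i) \<inter> region (coarse P i'))"
    using i i' by (intro negligible_region_Int[OF coarse_quads]) auto
  then have "negligible (cell M)"
    using sub[OF i x(1)] sub[OF i' x(2)] by (rule negligible_subset[OF _ Int_greatest])
  then show False using open_not_negligible[OF open_cell] M(2) by blast
qed

lemma phi_orthonormal:
  assumes p: "p \<in> aux_index" and q: "q \<in> aux_index"
  shows "ip_rho P (Dom P) (phi p) (phi q) = (if p = q then 1 else 0)"
proof -
  obtain i j where ij: "p = (i, j)" "i \<in> {1..n_coarse P}" "j \<in> {1..n_aux P i}"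
    using p by (auto simp: aux_index_def)
  obtain i' j' where ij': "q = (i', j')" "i' \<in> {1..n_coarse P}" "j' \<in> {1..n_aux P i'}"
    using q by (auto simp: aux_index_def)
  show ?thesis
  proof (cases "i = i'")
    case True
    then show ?thesis using eigen(2)[OF ij(2,3), of j'] ij ij' by (simp add: phi_def)
  next
    case False
    have "phi p x \<bullet> phi q x = 0" for x
      using coarse_supports_disjoint[OF ij(2) ij'(2) False eigen(1)[OF ij(2,3)] eigen(1)[OF ij'(2,3)]]
      by (simp add: phi_def ij ij')
    then show ?thesis using False ij(1) ij'(1) by (simp add: ip_rho_def ip_def)
  qed
qed

lemma psi:
  assumes "p \<in> aux_index"
  shows "psi p \<in> U_h P" and "aux_proj P (psi p) = phi p"
proof -
  obtain i j where ij: "p = (i, j)" "i \<in> {1..n_coarse P}" "j \<in> {1..n_aux P i}"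
    using assms by (auto simp: aux_index_def)
  have l: "localized_basis P" using multiscale by (simp add: multiscale_setup_def)
  have "is_arg_min (\<lambda>v. a_form P v v)
      (\<lambda>v. v \<in> U_on P (enlarged P i (layers P)) \<and> aux_proj P v = eigfun P i j) (basis_fun P i j)"
    using bspec[OF bspec[OF l[unfolded localized_basis_def] ij(2)] ij(3)] .
  then have b: "basis_fun P i j \<in> U_on P (enlarged P i (layers P))"
    "aux_proj P (basis_fun P i j) = eigfun P i j"
    by (simp_all add: is_arg_min_def)
  obtain S where S: "S \<subseteq> macros P" "enlarged P i (layers P) = (\<Union>M\<in>S. region M)"
    using enlarged_macros[OF ij(2), of "layers P"] by (elim exE conjE)
  have "basis_fun P i j \<in> U_h P" using b(1) U_on_subset[OF S(1)] unfolding S(2) by blast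
  then show "psi p \<in> U_h P" by (simp add: psi_def ij(1))
  show "aux_proj P (psi p) = phi p" using b(2) by (simp add: psi_def phi_def ij(1))
qed

lemma V_ms_eq: "V_ms P = fields.span (psi ` aux_index)"
proof -
  have "{basis_fun P i j | i j. i \<in> {1..n_coarse P} \<and> j \<in> {1..n_aux P i}} = psi ` aux_index"
  proof (intro subset_antisym subsetI)
    fix v assume "v \<in> {basis_fun P i j | i j. i \<in> {1..n_coarse P} \<and> j \<in> {1..n_aux P i}}"
    then obtain i j where "i \<in> {1..n_coarse P}" "j \<in> {1..n_aux P i}" "v = psi (i, j)"
      by (auto simp: psi_def)
    then show "v \<in> psi ` aux_index" by (auto simp: aux_index_def)
  next
    fix v assume "v \<in> psi ` aux_index"
    then obtain i j where "i \<in> {1..n_coarse P}" "j \<in> {1..n_aux P i}" "v = basis_fun P i j"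
      by (auto simp: psi_def aux_index_def)
    then show "v \<in> {basis_fun P i j | i j. i \<in> {1..n_coarse P} \<and> j \<in> {1..n_aux P i}}" by blast
  qed
  then show ?thesis by (simp add: V_ms_def)
qed

lemma subspace_V_ms: "fields.subspace (V_ms P)"
  unfolding V_ms_eq by (rule fields.subspace_span)

lemma V_ms_subset: "V_ms P \<subseteq> U_h P"
  unfolding V_ms_eq by (rule fields.span_minimal[OF _ subspace_U_h]) (use psi(1) in blast)

interpretation R: semi_inner fscale "bounded_fields (Dom P)" "ip_rho P (Dom P)"
  by (rule semi_inner_rho)

abbreviation coef :: "(pt \<Rightarrow> pt) \<Rightarrow> nat \<times> nat \<Rightarrow> real" where
  "coef v p \<equiv> ip_rho P (Dom P) v (phi p)"

lemma phi_bounded: "p \<in> aux_index \<Longrightarrow> phi p \<in> bounded_fields (Dom P)"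
  using phi_mem U_h_bounded by blast

lemma aux_proj_eq: "aux_proj P v = (\<Sum>p\<in>aux_index. fscale (coef v p) (phi p))"
  unfolding aux_proj_def aux_index_def phi_def by (subst sum.Sigma) (auto simp: split_beta)

lemma combination_bounded: "(\<Sum>p\<in>aux_index. fscale (c p) (phi p)) \<in> bounded_fields (Dom P)"
  by (intro R.sum_mem R.scale_mem phi_bounded)

lemma aux_proj_bounded: "aux_proj P v \<in> bounded_fields (Dom P)"
  unfolding aux_proj_eq by (rule combination_bounded)

lemma coef_combination:
  assumes q: "q \<in> aux_index"
  shows "coef (\<Sum>p\<in>aux_index. fscale (c p) (phi p)) q = c q"
proof -
  have "coef (\<Sum>p\<in>aux_index. fscale (c p) (phi p)) q = (\<Sum>p\<in>aux_index. coef (fscale (c p) (phi p)) q)"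
    by (intro R.sum_left R.scale_mem phi_bounded q)
  also have "\<dots> = (\<Sum>p\<in>aux_index. if p = q then c p else 0)"
    by (rule sum.cong) (simp_all add: R.scale_left phi_bounded phi_orthonormal q)
  also have "\<dots> = c q" using q finite_aux_index by simp
  finally show ?thesis .
qed

lemma coef_aux_proj: "q \<in> aux_index \<Longrightarrow> coef (aux_proj P v) q = coef v q"
  unfolding aux_proj_eq by (rule coef_combination)

lemma ip_rho_aux_proj: "ip_rho P (Dom P) (aux_proj P v) (aux_proj P w) = (\<Sum>p\<in>aux_index. coef v p * coef w p)"
proof -
  have "ip_rho P (Dom P) (aux_proj P v) (aux_proj P w)
      = (\<Sum>p\<in>aux_index. ip_rho P (Dom P) (aux_proj P v) (fscale (coef w p) (phi p)))"
    unfolding aux_proj_eq[of w] by (intro R.sum_right R.scale_mem phi_bounded aux_proj_bounded)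
  also have "\<dots> = (\<Sum>p\<in>aux_index. coef v p * coef w p)"
    by (rule sum.cong) (simp_all add: R.scale_right phi_bounded aux_proj_bounded coef_aux_proj)
  finally show ?thesis .
qed

lemma aux_proj_add:
  assumes "v \<in> bounded_fields (Dom P)" and "w \<in> bounded_fields (Dom P)"
  shows "aux_proj P (v + w) = aux_proj P v + aux_proj P w"
proof -
  have "aux_proj P (v + w) = (\<Sum>p\<in>aux_index. fscale (coef v p) (phi p) + fscale (coef w p) (phi p))"
    unfolding aux_proj_eq
    by (intro sum.cong refl)
      (simp only: R.add_left[OF assms phi_bounded] fields.scale_left_distrib)
  then show ?thesis by (simp only: sum.distrib aux_proj_eq)
qed

lemma aux_proj_scale:
  assumes "v \<in> bounded_fields (Dom P)"
  shows "aux_proj P (fscale c v) = fscale c (aux_proj P v)"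
proof -
  have "aux_proj P (fscale c v) = (\<Sum>p\<in>aux_index. fscale c (fscale (coef v p) (phi p)))"
    unfolding aux_proj_eq
    by (intro sum.cong refl) (simp only: R.scale_left[OF assms phi_bounded] fields.scale_scale)
  then show ?thesis by (simp only: fields.scale_sum_right aux_proj_eq)
qed

text \<open>The coefficients in the localized basis can be read off from the eigenfunctions, because
  the projection maps one family to the other.\<close>

lemma V_ms_expansion:
  assumes v: "v \<in> V_ms P"
  shows "(\<Sum>p\<in>aux_index. fscale (coef v p) (psi p)) = v"
proof -
  let ?rec = "\<lambda>v. \<Sum>p\<in>aux_index. fscale (coef v p) (psi p)"
  have b: "v \<in> bounded_fields (Dom P)" if "v \<in> U_h P" for v using that U_h_bounded by blast
  have add: "?rec (v + w) = ?rec v + ?rec w" if v: "v \<in> U_h P" and w: "w \<in> U_h P" for v w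
  proof -
    have "?rec (v + w) = (\<Sum>p\<in>aux_index. fscale (coef v p) (psi p) + fscale (coef w p) (psi p))"
      by (intro sum.cong refl)
        (simp only: R.add_left[OF b[OF v] b[OF w] phi_bounded] fields.scale_left_distrib)
    then show ?thesis by (simp only: sum.distrib)
  qed
  have scale: "?rec (fscale c v) = fscale c (?rec v)" if v: "v \<in> U_h P" for c v
  proof -
    have "?rec (fscale c v) = (\<Sum>p\<in>aux_index. fscale c (fscale (coef v p) (psi p)))"
      by (intro sum.cong refl) (simp only: R.scale_left[OF b[OF v] phi_bounded] fields.scale_scale)
    then show ?thesis by (simp only: fields.scale_sum_right)
  qed
  have zero: "?rec 0 = 0"
    using scale[OF fields.subspace_0[OF subspace_U_h], of 0] by (simp only: fields.scale_zero_left)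
  have "v \<in> U_h P \<and> ?rec v = v"
    using v unfolding V_ms_eq
  proof (rule fields.span_induct)
    show "fields.subspace {v. v \<in> U_h P \<and> ?rec v = v}"
      unfolding fields.subspace_def
    proof (intro conjI ballI allI)
      show "0 \<in> {v. v \<in> U_h P \<and> ?rec v = v}"
        using zero fields.subspace_0[OF subspace_U_h] by (simp only: mem_Collect_eq simp_thms)
      show "v + w \<in> {v. v \<in> U_h P \<and> ?rec v = v}"
        if "v \<in> {v. v \<in> U_h P \<and> ?rec v = v}" "w \<in> {v. v \<in> U_h P \<and> ?rec v = v}" for v w
      proof -
        have v: "v \<in> U_h P" "?rec v = v" and w: "w \<in> U_h P" "?rec w = w" using that by blast+
        have "?rec (v + w) = v + w" by (simp only: add[OF v(1) w(1)] v(2) w(2))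
        then show ?thesis using fields.subspace_add[OF subspace_U_h v(1) w(1)] by blast
      qed
      show "fscale c v \<in> {v. v \<in> U_h P \<and> ?rec v = v}"
        if "v \<in> {v. v \<in> U_h P \<and> ?rec v = v}" for c v
      proof -
        have v: "v \<in> U_h P" "?rec v = v" using that by blast+
        have "?rec (fscale c v) = fscale c v" by (simp only: scale[OF v(1)] v(2))
        then show ?thesis using fields.subspace_scale[OF subspace_U_h v(1)] by blast
      qed
    qed
    fix v assume "v \<in> psi ` aux_index"
    then obtain q where q: "q \<in> aux_index" "v = psi q" by blast
    have "coef v p = (if q = p then 1 else 0)" if p: "p \<in> aux_index" for p
      using coef_aux_proj[OF p, of v] phi_orthonormal[OF q(1) p] psi(2)[OF q(1)] q(2) by simp
    then have "?rec v = (\<Sum>p\<in>aux_index. if q = p then psi p else 0)"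
      by (intro sum.cong) (auto simp: fscale_def fun_eq_iff)
    also have "\<dots> = v" using q sum.delta'[OF finite_aux_index, of q psi] by (simp only: if_True)
    finally have "?rec v = v" .
    then show "v \<in> U_h P \<and> ?rec v = v" using psi(1)[OF q(1)] q(2) by blast
  qed
  then show ?thesis by blast
qed

text \<open>On the multiscale space the projection is injective, since it maps the localized basis to an
  orthonormal family.  The velocity is thus controlled by its projection, which is all that the
  discrete energy contains.\<close>

lemma norm_le_aux_proj:
  obtains B where "0 \<le> B"
    "\<And>v. v \<in> V_ms P \<Longrightarrow>
       ip_rho P (Dom P) v v \<le> B * ip_rho P (Dom P) (aux_proj P v) (aux_proj P v)"
proof
  define B where "B = (\<Sum>p\<in>aux_index. sqrt (ip_rho P (Dom P) (psi p) (psi p)))"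
  have psib: "psi p \<in> bounded_fields (Dom P)" if "p \<in> aux_index" for p
    using psi(1)[OF that] U_h_bounded by blast
  show "0 \<le> B\<^sup>2" by simp
  fix v assume v: "v \<in> V_ms P"
  have vb: "v \<in> bounded_fields (Dom P)" using v V_ms_subset U_h_bounded by blast
  define N where "N = ip_rho P (Dom P) (aux_proj P v) (aux_proj P v)"
  have N: "0 \<le> N" unfolding N_def by (rule R.nonneg[OF aux_proj_bounded])
  have coef: "\<bar>coef v p\<bar> \<le> sqrt N" if p: "p \<in> aux_index" for p
    using R.Cauchy_Schwarz[OF aux_proj_bounded phi_bounded[OF p], of v]
    by (simp add: coef_aux_proj[OF p] phi_orthonormal[OF p p] N_def)
  have "sqrt (ip_rho P (Dom P) v v)
      = sqrt (ip_rho P (Dom P) (\<Sum>p\<in>aux_index. fscale (coef v p) (psi p)) (\<Sum>p\<in>aux_index. fscale (coef v p) (psi p)))"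
    by (simp only: V_ms_expansion[OF v])
  also have "\<dots> \<le> (\<Sum>p\<in>aux_index.
      sqrt (ip_rho P (Dom P) (fscale (coef v p) (psi p)) (fscale (coef v p) (psi p))))"
    by (intro R.triangle_sum R.scale_mem psib)
  also have "\<dots> = (\<Sum>p\<in>aux_index. \<bar>coef v p\<bar> * sqrt (ip_rho P (Dom P) (psi p) (psi p)))"
    by (intro sum.cong refl R.sqrt_scale psib)
  also have "\<dots> \<le> (\<Sum>p\<in>aux_index. sqrt N * sqrt (ip_rho P (Dom P) (psi p) (psi p)))"
    by (intro sum_mono mult_right_mono coef) (simp_all add: R.nonneg psib)
  also have "\<dots> = B * sqrt N" by (simp add: B_def sum_distrib_left mult.commute)
  finally have "(sqrt (ip_rho P (Dom P) v v))\<^sup>2 \<le> (B * sqrt N)\<^sup>2"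
    by (intro power_mono) (simp_all add: R.nonneg vb)
  then show "ip_rho P (Dom P) v v \<le> B\<^sup>2 * ip_rho P (Dom P) (aux_proj P v) (aux_proj P v)"
    using N R.nonneg[OF vb] by (simp add: power_mult_distrib N_def)
qed

lemma semi_inner_projected:
  "semi_inner fscale (V_ms P) (\<lambda>v w. ip_rho P (Dom P) (aux_proj P v) (aux_proj P w))"
proof (rule semi_inner_fieldsI)
  have b: "v \<in> bounded_fields (Dom P)" if "v \<in> V_ms P" for v
    using that V_ms_subset U_h_bounded by blast
  show "functional_on fscale (V_ms P) (\<lambda>v. ip_rho P (Dom P) (aux_proj P v) (aux_proj P w))" for w
  proof (rule functional_onI)
    show "ip_rho P (Dom P) (aux_proj P (v + v')) (aux_proj P w)
        = ip_rho P (Dom P) (aux_proj P v) (aux_proj P w) + ip_rho P (Dom P) (aux_proj P v') (aux_proj P w)"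
      if "v \<in> V_ms P" "v' \<in> V_ms P" for v v'
      unfolding aux_proj_add[OF b[OF that(1)] b[OF that(2)]]
      by (rule R.add_left) (rule aux_proj_bounded)+
    show "ip_rho P (Dom P) (aux_proj P (fscale c v)) (aux_proj P w)
        = c * ip_rho P (Dom P) (aux_proj P v) (aux_proj P w)" if "v \<in> V_ms P" for c v
      unfolding aux_proj_scale[OF b[OF that]] by (rule R.scale_left) (rule aux_proj_bounded)+
  qed
qed (simp_all add: subspace_V_ms R.sym[OF aux_proj_bounded aux_proj_bounded] R.nonneg[OF aux_proj_bounded])

lemma semi_inner_a_form_V_ms: "semi_inner fscale (V_ms P) (a_form P)"
  by (rule semi_inner.restrict[OF semi_inner_a_form subspace_V_ms V_ms_subset])

text \<open>The source is merely square integrable.  The elementary bound \<open>|f| \<le> |f|\<^sup>2 + 1\<close> makes its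
  product with a bounded field integrable on the bounded domain.\<close>

lemma source_functional:
  assumes f: "f \<in> L2_fields (Dom P)"
  shows "functional_on fscale (bounded_fields (Dom P)) (ip (Dom P) f)"
proof -
  note eq = ip_eq_integral[OF fmeasurableD[OF domain(4)]]
  have meas: "f \<in> borel_measurable (lebesgue_on (Dom P))"
    and sq: "integrable (lebesgue_on (Dom P)) (\<lambda>x. (norm (f x))\<^sup>2)"
    using f by (auto simp: L2_fields_def)
  have int: "integrable (lebesgue_on (Dom P)) (\<lambda>x. f x \<bullet> g x)" if g: "g \<in> bounded_fields (Dom P)" for g
  proof -
    obtain B where B: "g \<in> borel_measurable (lebesgue_on (Dom P))" "0 \<le> B"
      "\<And>x. x \<in> Dom P \<Longrightarrow> norm (g x) \<le> B"
      using g by (rule bounded_fieldsE) blast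
    have "finite_measure (lebesgue_on (Dom P))" by (rule finite_measure_lebesgue_on[OF domain(4)])
    then have one: "integrable (lebesgue_on (Dom P)) (\<lambda>x. 1 :: real)"
      by (rule finite_measure.integrable_const)
    show ?thesis
    proof (rule Bochner_Integration.integrable_bound)
      show "integrable (lebesgue_on (Dom P)) (\<lambda>x. B * ((norm (f x))\<^sup>2 + 1))"
        using sq one by simp
      show "(\<lambda>x. f x \<bullet> g x) \<in> borel_measurable (lebesgue_on (Dom P))"
        using meas B(1) by (rule borel_measurable_inner)
      show "AE x in lebesgue_on (Dom P). norm (f x \<bullet> g x) \<le> norm (B * ((norm (f x))\<^sup>2 + 1))"
      proof (rule AE_I2)
        fix x assume "x \<in> space (lebesgue_on (Dom P))"
        then have x: "x \<in> Dom P" by simp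
        have "norm (f x \<bullet> g x) \<le> norm (f x) * norm (g x)"
          using Cauchy_Schwarz_ineq2[of "f x" "g x"] by simp
        also have "\<dots> \<le> ((norm (f x))\<^sup>2 + 1) * B"
        proof (rule mult_mono)
          have "2 * norm (f x) \<le> (norm (f x))\<^sup>2 + 1"
            using sum_squares_bound[of "norm (f x)" 1] by simp
          then show "norm (f x) \<le> (norm (f x))\<^sup>2 + 1" using norm_ge_zero[of "f x"] by linarith
        qed (use B(3)[OF x] in auto)
        finally show "norm (f x \<bullet> g x) \<le> norm (B * ((norm (f x))\<^sup>2 + 1))"
          using B(2) by (simp add: mult.commute)
      qed
    qed
  qed
  show ?thesis
  proof (rule functional_onI)
    show "ip (Dom P) f (g + g') = ip (Dom P) f g + ip (Dom P) f g'"
      if "g \<in> bounded_fields (Dom P)" "g' \<in> bounded_fields (Dom P)" for g g'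
      using int[OF that(1)] int[OF that(2)] by (simp add: eq inner_add_right)
    show "ip (Dom P) f (fscale c g) = c * ip (Dom P) f g" for c g
      by (simp add: eq fscale_def)
  qed
qed

text \<open>The projection is the orthogonal one with respect to the density-weighted product, and
  \<open>f\<close> has the same coefficients in plain \<open>L\<^sup>2\<close> as \<open>f / \<rho>\<close> in the weighted product.\<close>

lemma source_aux_proj:
  assumes f: "f \<in> L2_fields (Dom P)"
  shows "ip (Dom P) f (aux_proj P w)
    = ip_rho P (Dom P) (aux_proj P (\<lambda>x. (1 / rho P x) *\<^sub>R f x)) (aux_proj P w)"
proof -
  have coef: "coef (\<lambda>x. (1 / rho P x) *\<^sub>R f x) p = ip (Dom P) f (phi p)" for p
    unfolding ip_rho_def ip_eq_integral[OF fmeasurableD[OF domain(4)]]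
  proof (rule Bochner_Integration.integral_cong[OF refl])
    fix x assume "x \<in> space (lebesgue_on (Dom P))"
    then show "(rho P x *\<^sub>R (1 / rho P x) *\<^sub>R f x) \<bullet> phi p x = f x \<bullet> phi p x"
      using rho_pos[of x] by simp
  qed
  note L = source_functional[OF f]
  have "ip (Dom P) f (aux_proj P w) = (\<Sum>p\<in>aux_index. ip (Dom P) f (fscale (coef w p) (phi p)))"
    unfolding aux_proj_eq by (intro R.functional_sum[OF L] R.scale_mem phi_bounded)
  also have "\<dots> = (\<Sum>p\<in>aux_index. coef (\<lambda>x. (1 / rho P x) *\<^sub>R f x) p * coef w p)"
    by (rule sum.cong) (simp_all add: functional_on_scale[OF L] phi_bounded coef)
  finally show ?thesis by (simp add: ip_rho_aux_proj)
qed

end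

section \<open>Stability of the explicit multiscale scheme\<close>

theorem theorem4p3:
  fixes P :: ms_problem and \<kappa> \<beta> \<tau> :: real
  assumes discr: "multiscale_setup \<kappa> P"
    and beta: "\<beta> > 0"
    and inverse_ineq:
      "\<forall>v\<in>V_ms P. (norm_rho P (aux_proj P v))\<^sup>2 \<ge> \<beta> * (mesh_size_H P)\<^sup>2 * (norm_a P v)\<^sup>2"
    and tau: "\<tau> > 0"
    and CFL: "\<tau> / (2 * mesh_size_H P * sqrt \<beta>) < 1"
  shows "\<exists>C>0. \<forall>(T::real) (N_T::nat) (f::real \<Rightarrow> pt \<Rightarrow> pt) (u::nat \<Rightarrow> pt \<Rightarrow> pt).
    T > 0 \<and> N_T > 0 \<and> \<tau> = T / real N_T \<and>
    (\<forall>k\<le>N_T. f (real k * \<tau>) \<in> L2_fields (Dom P)) \<and>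
    explicit_scheme P \<tau> N_T (\<lambda>k. f (real k * \<tau>)) u \<longrightarrow>
    (\<forall>n<N_T.
       (norm_rho P (Dt_half \<tau> u n))\<^sup>2 + (norm_a P (mean_half u n))\<^sup>2
       \<le> C * (discrete_energy P \<tau> u 0
              + \<tau>\<^sup>2 * (\<Sum>k=1..n. norm_rho P (aux_proj P (\<lambda>x. (1 / rho P x) *\<^sub>R f (real k * \<tau>) x)))\<^sup>2))"
proof -
  interpret multiscale P \<kappa> by unfold_locales (rule discr)
  define m where "m v w = ip_rho P (Dom P) (aux_proj P v) (aux_proj P w)" for v w
  have m: "semi_inner fscale (V_ms P) m"
    unfolding m_def by (rule semi_inner_projected)
  have a: "semi_inner fscale (V_ms P) (a_form P)" by (rule semi_inner_a_form_V_ms)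
  interpret m: semi_inner fscale "V_ms P" m by (rule m)
  interpret a: semi_inner fscale "V_ms P" "a_form P" by (rule a)
  interpret R: semi_inner fscale "bounded_fields (Dom P)" "ip_rho P (Dom P)"
    by (rule semi_inner_rho)
  have norm_proj: "(norm_rho P (aux_proj P v))\<^sup>2 = m v v" for v
    by (simp add: norm_rho_def m_def R.nonneg aux_proj_bounded)
  have norm_a: "(norm_a P v)\<^sup>2 = a_form P v v" if "v \<in> V_ms P" for v
    using a.nonneg[OF that] by (simp add: norm_a_def)
  have norm_r: "(norm_rho P v)\<^sup>2 = ip_rho P (Dom P) v v" if "v \<in> V_ms P" for v
  proof -
    have "v \<in> bounded_fields (Dom P)" using that V_ms_subset U_h_bounded by blast
    then show ?thesis using R.nonneg[of v] by (simp add: norm_rho_def)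
  qed
  let ?H = "mesh_size_H P"
  have H: "0 < ?H" by (rule mesh_size_pos)
  \<comment> \<open>the square of the CFL number\<close>
  define \<theta> where "\<theta> = \<tau>\<^sup>2 / (4 * \<beta> * ?H\<^sup>2)"
  have "\<theta> = (\<tau> / (2 * ?H * sqrt \<beta>))\<^sup>2"
    using beta by (simp add: \<theta>_def power_divide power_mult_distrib)
  also have "\<dots> < 1"
    using CFL tau H beta by (simp add: power_less_one_iff)
  finally have theta: "\<theta> < 1" .
  have cfl: "\<tau>\<^sup>2 / 4 * a_form P v v \<le> \<theta> * m v v" if v: "v \<in> V_ms P" for v
  proof -
    have "\<beta> * ?H\<^sup>2 * a_form P v v \<le> m v v"
      using bspec[OF inverse_ineq v] unfolding norm_proj norm_a[OF v] .
    then have "\<theta> * (\<beta> * ?H\<^sup>2 * a_form P v v) \<le> \<theta> * m v v"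
      using beta by (intro mult_left_mono) (simp_all add: \<theta>_def)
    moreover have "\<theta> * (\<beta> * ?H\<^sup>2 * a_form P v v) = \<tau>\<^sup>2 / 4 * a_form P v v"
      using beta H by (simp add: \<theta>_def)
    ultimately show ?thesis by simp
  qed
  obtain B where B: "0 \<le> B" "\<And>v. v \<in> V_ms P \<Longrightarrow> ip_rho P (Dom P) v v \<le> B * m v v"
    using norm_le_aux_proj[folded m_def] by blast
  \<comment> \<open>\<open>K\<close> bounds the left-hand side by the energy at the same time; \<open>C\<close> also pays for the growth
    of the energy\<close>
  define K where "K = 2 * B / (1 - \<theta>) + 2"
  define C where "C = K * (2 + 1 / (1 - \<theta>))"
  have K: "0 < K" using B(1) theta by (simp add: K_def add_nonneg_pos)
  then have C: "0 < C" using theta by (simp add: C_def add_pos_pos)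
  show ?thesis
  proof (intro exI[of _ C] conjI allI impI C)
    fix T :: real and N and f :: "real \<Rightarrow> pt \<Rightarrow> pt" and u :: "nat \<Rightarrow> pt \<Rightarrow> pt" and n
    assume asm: "T > 0 \<and> N > 0 \<and> \<tau> = T / real N \<and>
      (\<forall>k\<le>N. f (real k * \<tau>) \<in> L2_fields (Dom P)) \<and>
      explicit_scheme P \<tau> N (\<lambda>k. f (real k * \<tau>)) u" and n: "n < N"
    have scheme: "explicit_scheme P \<tau> N (\<lambda>k. f (real k * \<tau>)) u" using asm by blast
    define F where "F k = norm_rho P (aux_proj P (\<lambda>x. (1 / rho P x) *\<^sub>R f (real k * \<tau>) x))" for k
    define E where "E k = leapfrog_energy m (a_form P) \<tau> (u k) (u (Suc k))" for k
    have f: "f (real k * \<tau>) \<in> L2_fields (Dom P)" if "k \<le> N" for k using asm that by blast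
    have u: "u k \<in> V_ms P" if "k \<le> N" for k using scheme that by (simp add: explicit_scheme_def)
    have F: "0 \<le> F k" for k
      unfolding F_def norm_rho_def by (intro real_sqrt_ge_zero R.nonneg aux_proj_bounded)
    have step: "m (u (k + 1) - fscale 2 (u k) + u (k - 1)) w / \<tau>\<^sup>2 + a_form P (u k) w \<le> F k * sqrt (m w w)"
      if k: "1 \<le> k" "k < N" and w: "w \<in> V_ms P" for k w
    proof -
      let ?g = "\<lambda>x. (1 / rho P x) *\<^sub>R f (real k * \<tau>) x"
      have uV: "u (k + 1) \<in> V_ms P" "u k \<in> V_ms P" "u (k - 1) \<in> V_ms P" using k by (auto intro!: u)
      have d: "u (k + 1) - fscale 2 (u k) + u (k - 1) \<in> V_ms P" by (intro m.mem uV)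
      have "m (u (k + 1) - fscale 2 (u k) + u (k - 1)) w / \<tau>\<^sup>2 = m (Dtt \<tau> u k) w"
        unfolding Dtt_def m.scale_left[OF d w] by simp
      moreover have "m (Dtt \<tau> u k) w + a_form P (u k) w = ip (Dom P) (f (real k * \<tau>)) (aux_proj P w)"
        using scheme k w unfolding explicit_scheme_def m_def by blast
      moreover have "ip (Dom P) (f (real k * \<tau>)) (aux_proj P w)
          = ip_rho P (Dom P) (aux_proj P ?g) (aux_proj P w)"
        by (rule source_aux_proj[OF f]) (use k in simp)
      moreover have "\<bar>ip_rho P (Dom P) (aux_proj P ?g) (aux_proj P w)\<bar> \<le> F k * sqrt (m w w)"
        using R.Cauchy_Schwarz[OF aux_proj_bounded aux_proj_bounded] by (simp only: F_def norm_rho_def m_def)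
      ultimately show ?thesis by linarith
    qed
    let ?d = "\<lambda>k. u (Suc k) - u k" and ?s = "\<lambda>k. u (Suc k) + u k"
    have mem: "?d k \<in> V_ms P" "?s k \<in> V_ms P" if "k < N" for k
      using that by (auto intro!: m.diff_mem m.add_mem u)
    have Dt: "Dt_half \<tau> u k = fscale (1 / \<tau>) (?d k)" "mean_half u k = fscale (1 / 2) (?s k)" for k
      by (simp_all only: Dt_half_def mean_half_def Suc_eq_plus1)
    have DtV: "Dt_half \<tau> u k \<in> V_ms P" "mean_half u k \<in> V_ms P" if "k < N" for k
      unfolding Dt by (intro m.scale_mem mem that)+
    have mDt: "m (Dt_half \<tau> u k) (Dt_half \<tau> u k) = m (?d k) (?d k) / \<tau>\<^sup>2"
      and aDt: "a_form P (Dt_half \<tau> u k) (Dt_half \<tau> u k) = a_form P (?d k) (?d k) / \<tau>\<^sup>2"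
      and amean: "a_form P (mean_half u k) (mean_half u k) = a_form P (?s k) (?s k) / 4" if k: "k < N" for k
      unfolding Dt
      by (simp_all only: m.scale_left a.scale_left m.scale_right a.scale_right m.scale_mem a.scale_mem mem[OF k])
        (simp_all add: power2_eq_square)
    have energy0: "discrete_energy P \<tau> u 0 = E 0"
    proof -
      have 0: "0 < N" using n by simp
      have uV: "u 0 \<in> V_ms P" "u (Suc 0) \<in> V_ms P" using 0 by (auto intro!: u)
      have "a_form P (?s 0) (?s 0) - a_form P (?d 0) (?d 0) = 4 * a_form P (u (Suc 0)) (u 0)"
        using a.sym[OF uV]
        by (simp only: a.expand a.mem uV)
      then show ?thesis
        using tau unfolding discrete_energy_def norm_proj norm_a[OF DtV(1)[OF 0]] norm_a[OF DtV(2)[OF 0]]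
          mDt[OF 0] aDt[OF 0] amean[OF 0] E_def leapfrog_energy_def
        by (simp add: field_simps)
    qed
    have lower: "(1 - \<theta>) / (2 * \<tau>\<^sup>2) * m (?d k) (?d k) + a_form P (?s k) (?s k) / 8 \<le> E k" if "k < N" for k
      unfolding E_def
      by (rule leapfrog_stability(1)[where N = N and F = F]; (rule m a tau theta F that cfl u step; assumption?))
    have upper: "E n \<le> 2 * E 0 + \<tau>\<^sup>2 / (1 - \<theta>) * (\<Sum>k=1..n. F k)\<^sup>2"
      unfolding E_def
      by (rule leapfrog_stability(2)[where N = N]; (rule m a tau theta F n cfl u step; assumption?))
    have parts: "0 \<le> m (?d k) (?d k)" "0 \<le> a_form P (?s k) (?s k)" if "k < N" for k
      by (intro m.nonneg a.nonneg mem that)+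
    have velocity: "m (?d k) (?d k) / \<tau>\<^sup>2 \<le> 2 / (1 - \<theta>) * E k" and position: "a_form P (?s k) (?s k) / 4 \<le> 2 * E k"
      and E0: "0 \<le> E k" if k: "k < N" for k
    proof -
      have p: "0 \<le> (1 - \<theta>) / (2 * \<tau>\<^sup>2) * m (?d k) (?d k)" using theta parts(1)[OF k] by simp
      show "a_form P (?s k) (?s k) / 4 \<le> 2 * E k" "0 \<le> E k" using lower[OF k] p parts(2)[OF k] by linarith+
      have "(1 - \<theta>) / (2 * \<tau>\<^sup>2) * m (?d k) (?d k) \<le> E k" using lower[OF k] parts(2)[OF k] by linarith
      then have "2 / (1 - \<theta>) * ((1 - \<theta>) / (2 * \<tau>\<^sup>2) * m (?d k) (?d k)) \<le> 2 / (1 - \<theta>) * E k"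
        using theta by (intro mult_left_mono) simp_all
      then show "m (?d k) (?d k) / \<tau>\<^sup>2 \<le> 2 / (1 - \<theta>) * E k" using theta by simp
    qed
    have "(norm_rho P (Dt_half \<tau> u n))\<^sup>2 + (norm_a P (mean_half u n))\<^sup>2
        \<le> B * (m (?d n) (?d n) / \<tau>\<^sup>2) + a_form P (?s n) (?s n) / 4"
      using B(2)[OF DtV(1)[OF n]] unfolding norm_r[OF DtV(1)[OF n]] norm_a[OF DtV(2)[OF n]] mDt[OF n] amean[OF n]
      by linarith
    also have "\<dots> \<le> B * (2 / (1 - \<theta>) * E n) + 2 * E n"
      by (intro add_mono mult_left_mono velocity[OF n] position[OF n] B(1))
    also have "\<dots> = K * E n" by (simp add: K_def algebra_simps)
    also have "\<dots> \<le> K * ((2 + 1 / (1 - \<theta>)) * (E 0 + \<tau>\<^sup>2 * (\<Sum>k=1..n. F k)\<^sup>2))"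
    proof (rule mult_left_mono)
      have "0 \<le> E 0 / (1 - \<theta>) + 2 * (\<tau>\<^sup>2 * (\<Sum>k=1..n. F k)\<^sup>2)"
        using E0[of 0] n theta by simp
      then show "E n \<le> (2 + 1 / (1 - \<theta>)) * (E 0 + \<tau>\<^sup>2 * (\<Sum>k=1..n. F k)\<^sup>2)"
        using upper by (simp add: algebra_simps)
    qed (use K in simp)
    also have "\<dots> = C * (discrete_energy P \<tau> u 0 + \<tau>\<^sup>2 * (\<Sum>k=1..n. F k)\<^sup>2)"
      by (simp add: C_def energy0)
    finally show "(norm_rho P (Dt_half \<tau> u n))\<^sup>2 + (norm_a P (mean_half u n))\<^sup>2
       \<le> C * (discrete_energy P \<tau> u 0 + \<tau>\<^sup>2 *
          (\<Sum>k=1..n. norm_rho P (aux_proj P (\<lambda>x. (1 / rho P x) *\<^sub>R f (real k * \<tau>) x)))\<^sup>2)"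
      unfolding F_def .
  qed
qed

end
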